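(* Consider the system $\dot x=f(x,u,d)$, $y=h(x)$ with the sampled controller $u(t)=\kappa(y(t_k))$, $t\in[t_k,t_{k+1})$, $k\in\mathbb{N}$, and suppose that its impulsive form with state $x$ and sampling error $\varpi$ satisfies Assumption A (see context). Let $\alpha_q\in\mathcal{K}_\infty$ satisfy $\alpha_q(s)>2\sigma_\varpi(s)$ for $s>0$ and $\alpha_q(s)=\mathcal{O}(\alpha(s))$ as $s\to0^+$, and let $V_q$ be an associated ISS-Lyapunov function $V_q(x)\sim\{\underline{\alpha}_q,\bar\alpha_q,\alpha_q,\sigma_q\mid\dot x=f_c(x,\varpi,d)\}$ with $\underline{\alpha}_q,\bar\alpha_q,\sigma_q\in\mathcal{K}_\infty$. Let $\hat\alpha_\varpi,\gamma\in\mathcal{K}_\infty$ satisfy $\hat\alpha_\varpi(s)>\sigma_q(s)/2$ and $\gamma(s)>\hat\alpha_\varpi(s)+\alpha_\varpi(s)$ for $s>0$. Suppose $\varpi(t_0)=0$, and that $\sigma_\varpi(s)=\mathcal{O}(\alpha(s))$ and $\gamma(s)=\mathcal{O}(\underline{\alpha}_\varpi(s))$ as $s\to0^+$. If the sampling instants are generated by the event-triggered law $$t_{k+1}=\inf_{t\ge t_k}\Big\{\,2(t-t_k)\,\gamma(\|\varpi_{[t_k,t]}\|)\ \ge\ \max_{\tau\in[t_k,t]}U(\varpi(\tau)),\ \text{ and }\ \|\varpi_{[t_k,t]}\|\neq0\Big\},$$ then the equilibrium point $x=0$ of the closed-loop system is globally asymptotically stable and Zeno behavior is avoided. Moreover,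 $V_q(x(t))\le V_q(x(t_k))$ for all $t\in[t_k,t_{k+1}]$ and all $k\in\mathbb{N}$.
   Context: System: $x\in\mathbb{R}^n$ is the state, $y\in\mathbb{R}^q$ the output, $u\in\mathbb{R}^m$ the input, and $d=d(t)\in\mathbb{R}^{n_d}$ is an uncertainty taking values in a compact set $\mathbb{D}$. The function $f$ is continuously differentiable with $f(0,0,d)=0$ for $d\in\mathbb D$; $h(0)=0$; $\kappa$ is continuously differentiable with $\kappa(0)=0$, and $\kappa\circ h$ is differentiable. The continuous-time feedback $u(t)=\kappa(y(t))$ is supposed to stabilize the equilibrium. Sampling error: $\varpi(t)=\kappa\circ h(x(t_k))-\kappa\circ h(x(t))$ for $t\in[t_k,t_{k+1})$. The closed-loop system has the impulsive form $\dot x=f_c(x,\varpi,d):=f(x,\kappa\circ h(x)+\varpi,d)$, $\dot\varpi=\psi(x,\varpi,d):=-\frac{\partial(\kappa\circ h)(x)}{\partial x}f_c(x,\varpi,d)$ for $t\in[t_k,t_{k+1})$, and $\varpi(t_k^+)=0$. On an interval $[t_k,t]$ in the sampling law, $\varpi$ denotes the error relative to the sample at $t_k$ (so it starts from $0$ at $t_k$ and evolves continuously), and the infimum is over those $t$ for which the condition in braces holds ($+\infty$ if none). Notation: $\mathbb{N}$ is the set of non-negative integers; $\|x_{[a,b]}\|=\sup_{t\in[a,b]}\|x(t)\|$. For $\mathcal{K}_\infty$ functions, $\alpha'(s)=\mathcal{O}(\alpha(s))$ as $s\to0^+$ means $\limsup_{s\to0^+}\alpha'(s)/\alpha(s)<\infty$.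 For a continuously differentiable $V:\mathbb{R}^n\to\mathbb{R}_{\ge0}$, $V(x)\sim\{\underline{\alpha},\bar\alpha,\alpha,\sigma\mid\dot x=f_c(x,\varpi,d)\}$ ("ISS-Lyapunov function") means $\underline{\alpha},\bar\alpha,\alpha,\sigma\in\mathcal{K}_\infty$ and, for all $x\in\mathbb{R}^n,\varpi\in\mathbb{R}^m,d\in\mathbb{D}$, $\underline{\alpha}(\|x\|)\le V(x)\le\bar\alpha(\|x\|)$ and, along $\dot x=f_c(x,\varpi,d)$, $\dot V(x)\le-\alpha(\|x\|)+\sigma(\|\varpi\|)$. Assumption A: The $x$-subsystem has an ISS-Lyapunov function $V(x)\sim\{\underline{\alpha},\bar\alpha,\alpha,\sigma\mid\dot x=f_c(x,\varpi,d)\}$. There exists a continuously differentiable $U:\mathbb{R}^m\to\mathbb{R}_{\ge0}$ such that, for all $x\in\mathbb{R}^n,\varpi\in\mathbb{R}^m,d\in\mathbb{D}$, $\underline{\alpha}_\varpi(\|\varpi\|)\le U(\varpi)\le\bar\alpha_\varpi(\|\varpi\|)$ and $\dot U(\varpi)=\big(\frac{\partial U(\varpi)}{\partial\varpi}\big)^{T}\psi(x,\varpi,d)\le\alpha_\varpi(\|\varpi\|)+\sigma_\varpi(\|x\|)$ for some $\underline{\alpha}_\varpi,\bar\alpha_\varpi,\alpha_\varpi,\sigma_\varpi\in\mathcal{K}_\infty$. Given $\alpha_q=\mathcal{O}(\alpha)$ as $s\to0^+$, such a function $V_q$ (and $\underline{\alpha}_q,\bar\alpha_q,\sigma_q$)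 exists by the standard changing-supply-function technique applied to $V$. Zeno behavior is avoided means that only a finite number of events are triggered in any finite amount of time. *)

theory Defs
  imports "HOL-Analysis.Analysis"
begin

definition class_K_inf :: "(real \<Rightarrow> real) \<Rightarrow> bool" where
  "class_K_inf a \<longleftrightarrow>
     continuous_on {0..} a \<and> strict_mono_on {0..} a \<and> a 0 = 0 \<and> filterlim a at_top at_top"

definition bigO_at_zero :: "(real \<Rightarrow> real) \<Rightarrow> (real \<Rightarrow> real) \<Rightarrow> bool" where
  "bigO_at_zero a' a \<longleftrightarrow> Limsup (at_right 0) (\<lambda>s. ereal (a' s / a s)) < \<infinity>"

definition continuously_differentiable ::
    "('a::real_normed_vector \<Rightarrow> 'b::real_normed_vector) \<Rightarrow> bool" where
  "continuously_differentiable F \<longleftrightarrow>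
     (\<exists>F'. (\<forall>x. (F has_derivative blinfun_apply (F' x)) (at x)) \<and> continuous_on UNIV F')"

text \<open>In \<open>f_c\<close> and \<open>psi\<close>, \<open>g\<close> stands for \<open>\<kappa> \<circ> h\<close>; \<open>psi\<close> is the velocity of the sampling error
  \<open>w = g (x(t_k)) - g (x(t))\<close>.\<close>

definition f_c :: "('x \<Rightarrow> 'u::plus \<Rightarrow> 'd \<Rightarrow> 'x) \<Rightarrow> ('x \<Rightarrow> 'u) \<Rightarrow> 'x \<Rightarrow> 'u \<Rightarrow> 'd \<Rightarrow> 'x" where
  "f_c f g x w d = f x (g x + w) d"

definition psi ::
    "('x::real_normed_vector \<Rightarrow> 'u::real_normed_vector \<Rightarrow> 'd \<Rightarrow> 'x) \<Rightarrow> ('x \<Rightarrow> 'u) \<Rightarrow> 'x \<Rightarrow> 'u \<Rightarrow> 'd \<Rightarrow> 'u" where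
  "psi f g x w d = - frechet_derivative g (at x) (f_c f g x w d)"

definition ISS_Lyapunov ::
    "('x::real_normed_vector \<Rightarrow> real) \<Rightarrow> (real \<Rightarrow> real) \<Rightarrow> (real \<Rightarrow> real) \<Rightarrow> (real \<Rightarrow> real) \<Rightarrow>
     (real \<Rightarrow> real) \<Rightarrow> ('x \<Rightarrow> 'w::real_normed_vector \<Rightarrow> 'd \<Rightarrow> 'x) \<Rightarrow> 'd set \<Rightarrow> bool" where
  "ISS_Lyapunov V a_lo a_hi a sg F D \<longleftrightarrow>
     continuously_differentiable V \<and> (\<forall>x. 0 \<le> V x) \<and>
     class_K_inf a_lo \<and> class_K_inf a_hi \<and> class_K_inf a \<and> class_K_inf sg \<and>
     (\<forall>x. a_lo (norm x) \<le> V x \<and> V x \<le> a_hi (norm x)) \<and>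
     (\<forall>x w. \<forall>d\<in>D. frechet_derivative V (at x) (F x w d) \<le> - a (norm x) + sg (norm w))"

definition error_growth ::
    "('w::real_normed_vector \<Rightarrow> real) \<Rightarrow> (real \<Rightarrow> real) \<Rightarrow> (real \<Rightarrow> real) \<Rightarrow> (real \<Rightarrow> real) \<Rightarrow>
     (real \<Rightarrow> real) \<Rightarrow> ('x::real_normed_vector \<Rightarrow> 'w \<Rightarrow> 'd \<Rightarrow> 'w) \<Rightarrow> 'd set \<Rightarrow> bool" where
  "error_growth U a_lo a_hi a sg G D \<longleftrightarrow>
     continuously_differentiable U \<and> (\<forall>w. 0 \<le> U w) \<and>
     class_K_inf a_lo \<and> class_K_inf a_hi \<and> class_K_inf a \<and> class_K_inf sg \<and>
     (\<forall>w. a_lo (norm w) \<le> U w \<and> U w \<le> a_hi (norm w)) \<and>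
     (\<forall>x w. \<forall>d\<in>D. frechet_derivative U (at w) (G x w d) \<le> a (norm w) + sg (norm x))"

definition sup_norm_on :: "real \<Rightarrow> real \<Rightarrow> (real \<Rightarrow> 'a::real_normed_vector) \<Rightarrow> real" where
  "sup_norm_on a b z = (SUP t\<in>{a..b}. norm (z t))"

definition sampling_error :: "('x \<Rightarrow> 'u::minus) \<Rightarrow> (real \<Rightarrow> 'x) \<Rightarrow> real \<Rightarrow> real \<Rightarrow> 'u" where
  "sampling_error g x s t = g (x s) - g (x t)"

text \<open>The supremum of \<open>U\<close> along the error is the maximum whenever \<open>g \<circ> x\<close> is continuous on
  \<open>{s..t}\<close>, which holds along every closed-loop execution.\<close>

definition event ::
    "(real \<Rightarrow> real) \<Rightarrow> ('u::real_normed_vector \<Rightarrow> real) \<Rightarrow> ('x \<Rightarrow> 'u) \<Rightarrow> (real \<Rightarrow> 'x) \<Rightarrow> real \<Rightarrow> real \<Rightarrow> bool" where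
  "event \<gamma> U g x s t \<longleftrightarrow>
     2 * (t - s) * \<gamma> (sup_norm_on s t (sampling_error g x s)) \<ge>
       (SUP \<tau>\<in>{s..t}. U (sampling_error g x s \<tau>)) \<and>
     sup_norm_on s t (sampling_error g x s) \<noteq> 0"

definition disturbances :: "'d::euclidean_space set \<Rightarrow> real \<Rightarrow> (real \<Rightarrow> 'd) set" where
  "disturbances D t0 = {d. d \<in> borel_measurable (lebesgue_on {t0..}) \<and> (\<forall>t\<ge>t0. d t \<in> D)}"

text \<open>An execution on \<open>[t0, T)\<close>, where \<open>T\<close> may be \<open>\<infinity>\<close>, of the closed loop with input
  \<open>u t = \<kappa> (h (x (tk k)))\<close> on \<open>[tk k, tk (Suc k))\<close>.  As the disturbance is only measurable,
  the differential equation is read in integral (Caratheodory) form.  \<open>tk (Suc k) = \<infinity>\<close>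
  (the infimum of the empty set) means that no further event occurs before \<open>T\<close>.
  The last clause says that the sampling intervals cover \<open>[t0, T)\<close>, so that an execution cannot
  run past an accumulation point of the sampling instants.  Since \<open>tk 0 = t0\<close> is a sampling
  instant, the sampling error vanishes at \<open>t0\<close>.

  The infimum ranges over the actual trajectory.  Its values after \<open>tk (Suc k)\<close>, where the input
  has been updated, are immaterial: either the condition already holds at \<open>tk (Suc k)\<close>, or the
  error is identically zero up to there and the update leaves the input unchanged.\<close>

definition execution ::
    "('x::euclidean_space \<Rightarrow> 'u::real_normed_vector \<Rightarrow> 'd \<Rightarrow> 'x) \<Rightarrow> ('y \<Rightarrow> 'u) \<Rightarrow> ('x \<Rightarrow> 'y) \<Rightarrow>
     (real \<Rightarrow> real) \<Rightarrow> ('u \<Rightarrow> real) \<Rightarrow> real \<Rightarrow>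
     ereal \<Rightarrow> (real \<Rightarrow> 'd) \<Rightarrow> (real \<Rightarrow> 'x) \<Rightarrow> (nat \<Rightarrow> ereal) \<Rightarrow> bool" where
  "execution f \<kappa> h \<gamma> U t0 T d x tk \<longleftrightarrow>
     ereal t0 < T \<and> tk 0 = ereal t0 \<and>
     (\<forall>k. tk (Suc k) =
        Inf {ereal t | t. tk k \<le> ereal t \<and> ereal t < T \<and>
                          event \<gamma> U (\<kappa> \<circ> h) x (real_of_ereal (tk k)) t}) \<and>
     (\<forall>k t. tk k \<le> ereal t \<and> ereal t \<le> tk (Suc k) \<and> ereal t < T \<longrightarrow>
        ((\<lambda>s. f (x s) (\<kappa> (h (x (real_of_ereal (tk k))))) (d s))
           has_integral (x t - x (real_of_ereal (tk k)))) {real_of_ereal (tk k)..t}) \<and>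
     T \<le> (SUP k. tk k)"

definition closed_loop_solution ::
    "('x::euclidean_space \<Rightarrow> 'u::real_normed_vector \<Rightarrow> 'd \<Rightarrow> 'x) \<Rightarrow> ('y \<Rightarrow> 'u) \<Rightarrow> ('x \<Rightarrow> 'y) \<Rightarrow>
     (real \<Rightarrow> real) \<Rightarrow> ('u \<Rightarrow> real) \<Rightarrow> real \<Rightarrow>
     ereal \<Rightarrow> (real \<Rightarrow> 'd) \<Rightarrow> (real \<Rightarrow> 'x) \<Rightarrow> bool" where
  "closed_loop_solution f \<kappa> h \<gamma> U t0 T d x \<longleftrightarrow> (\<exists>tk. execution f \<kappa> h \<gamma> U t0 T d x tk)"

definition maximal_solution ::
    "real \<Rightarrow> (ereal \<Rightarrow> (real \<Rightarrow> 'd) \<Rightarrow> (real \<Rightarrow> 'x) \<Rightarrow> bool) \<Rightarrow>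
     ereal \<Rightarrow> (real \<Rightarrow> 'd) \<Rightarrow> (real \<Rightarrow> 'x) \<Rightarrow> bool" where
  "maximal_solution t0 S T d x \<longleftrightarrow> S T d x \<and>
     \<not> (\<exists>T' x'. T < T' \<and> S T' d x' \<and> (\<forall>t. t0 \<le> t \<and> ereal t < T \<longrightarrow> x' t = x t))"

text \<open>Global asymptotic stability of the origin, uniformly over the disturbances in \<open>W\<close>.
  \<open>S T d x\<close> means that \<open>x\<close> solves the system on \<open>[t0, T)\<close> under \<open>d\<close>.  The clauses are:
  existence for all time from every initial state, no premature end of maximal solutions
  (by finite escape or by accumulation of events), Lyapunov stability, uniform boundedness,
  and uniform global attractivity.\<close>

definition globally_asymptotically_stable ::
    "real \<Rightarrow> (real \<Rightarrow> 'd) set \<Rightarrow>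
     (ereal \<Rightarrow> (real \<Rightarrow> 'd) \<Rightarrow> (real \<Rightarrow> 'x::real_normed_vector) \<Rightarrow> bool) \<Rightarrow> bool" where
  "globally_asymptotically_stable t0 W S \<longleftrightarrow>
     (\<forall>d\<in>W. \<forall>\<xi>. \<exists>x. x t0 = \<xi> \<and> S \<infinity> d x) \<and>
     (\<forall>d\<in>W. \<forall>T x. maximal_solution t0 S T d x \<longrightarrow> T = \<infinity>) \<and>
     (\<forall>\<epsilon>>0. \<exists>\<delta>>0. \<forall>d\<in>W. \<forall>T x. S T d x \<and> norm (x t0) < \<delta> \<longrightarrow>
        (\<forall>t. t0 \<le> t \<and> ereal t < T \<longrightarrow> norm (x t) < \<epsilon>)) \<and>
     (\<forall>r>0. \<exists>B. \<forall>d\<in>W. \<forall>T x. S T d x \<and> norm (x t0) \<le> r \<longrightarrow>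
        (\<forall>t. t0 \<le> t \<and> ereal t < T \<longrightarrow> norm (x t) \<le> B)) \<and>
     (\<forall>r>0. \<forall>\<epsilon>>0. \<exists>\<theta>\<ge>0. \<forall>d\<in>W. \<forall>T x. S T d x \<and> norm (x t0) \<le> r \<longrightarrow>
        (\<forall>t. t0 + \<theta> \<le> t \<and> ereal t < T \<longrightarrow> norm (x t) < \<epsilon>))"

end

theory Submission
  imports Defs
begin

text \<open>While the input is held, every function \<open>\<Phi>\<close> of the state that is merely differentiable has along the
  trajectory an upper right Dini derivative bounded by the supremum over \<open>D\<close> of its derivative along
  \<open>f\<close>; hence neither differentiability of the trajectory nor absolute continuity of the sampling
  error \<open>w\<close> is needed.  Apply this to \<open>V + 2 U(w)\<close> up to the time of the sampling interval
  \<open>[s, t]\<close> at which \<open>U(w)\<close> is maximal and to \<open>V\<close> alone afterwards.  As long as no event occurs, with \<open>S\<close>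
  the supremum of \<open>\<parallel>w\<parallel>\<close>, this yields \<open>V(x(t)) \<le> V(x(s)) - 2 (t - s) \<gamma>(S)\<close>.  So \<open>V\<close> decays at a uniform
  rate while \<open>S\<close> is bounded below, and for small \<open>S\<close> it decays at a uniform rate by the dissipation
  inequality alone, as long as \<open>V\<close> itself is bounded below.  Since \<open>\<gamma>\<close> is of the order of the lower
  bound of \<open>U\<close>, an event in a bounded region needs a minimal time, and solutions can be continued by
  a uniform time step.\<close>

text \<open>The obstacle to continuation is that an execution carries its horizon \<open>T\<close>:
  the law takes the infimum over the events before \<open>T\<close> along the actual trajectory.
  Lengthening the horizon can turn the first instant \<open>\<infinity>\<close> into a finite one,
  and updating the input there changes the very trajectory over which the infimum is taken.
  Executions with different horizons are therefore compared by truncating their instants, and every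
  continued trajectory is checked against the law again.

  A uniform time step is available because the local existence time and the minimal time to an event
  depend only on a bound for \<open>V\<close>. Since \<open>V\<close> never exceeds its initial
  value along an execution, the same step can be repeated without end, and no separate argument
  against finite escape is required.\<close>

lemma compact_Icc_subset:
  fixes A :: "real set"
  assumes "closed A" "A \<subseteq> {a..b}"
  shows "compact A"
  using assms by (meson bounded_closed_interval bounded_subset compact_eq_bounded_closed)

text \<open>Subtract the line of slope \<open>c + \<epsilon>\<close>. The times at which the
  difference is at most its initial value form a closed set, and the Dini bound moves any point of
  it below \<open>b\<close> further to the right. So its last point is \<open>b\<close>; then let
  \<open>\<epsilon>\<close> tend to 0.\<close>

lemma right_dini_bound:
  fixes \<phi> :: "real \<Rightarrow> real"
  assumes "a \<le> b" and cont: "continuous_on {a..b} \<phi>"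
    and dini: "\<And>t \<epsilon>. a \<le> t \<Longrightarrow> t < b \<Longrightarrow> 0 < \<epsilon> \<Longrightarrow>
      \<forall>\<^sub>F \<tau> in at_right t. \<phi> \<tau> - \<phi> t \<le> (c + \<epsilon>) * (\<tau> - t)"
  shows "\<phi> b - \<phi> a \<le> c * (b - a)"
proof -
  have *: "\<phi> b - \<phi> a \<le> (c + \<epsilon>) * (b - a)" if "\<epsilon> > 0" for \<epsilon>
  proof (rule ccontr)
    define \<psi> where "\<psi> t = \<phi> t - (c + \<epsilon>) * t" for t
    define A where "A = {t \<in> {a..b}. \<psi> t \<le> \<psi> a}"
    assume "\<not> ?thesis"
    then have gt: "\<psi> b > \<psi> a" by (simp add: \<psi>_def algebra_simps)
    have "continuous_on {a..b} \<psi>"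
      unfolding \<psi>_def by (intro continuous_intros cont)
    then have "closed A"
      unfolding A_def by (intro continuous_on_closed_Collect_le continuous_intros) auto
    then have "compact A"
      by (rule compact_Icc_subset) (auto simp: A_def)
    moreover have "a \<in> A" using \<open>a \<le> b\<close> by (simp add: A_def)
    ultimately obtain m where m: "m \<in> A" "\<And>t. t \<in> A \<Longrightarrow> t \<le> m"
      using compact_attains_sup[of A] by blast
    have "m < b" using m(1) gt by (auto simp: A_def less_le)
    moreover have "a \<le> m" using m(1) by (auto simp: A_def)
    ultimately have "\<forall>\<^sub>F \<tau> in at_right m. \<phi> \<tau> - \<phi> m \<le> (c + \<epsilon>) * (\<tau> - m) \<and> \<tau> \<in> {m<..<b}"
      using dini[of m \<epsilon>] that eventually_at_right_real[of m b] by (auto intro: eventually_conj)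
    then obtain \<tau> where "\<phi> \<tau> - \<phi> m \<le> (c + \<epsilon>) * (\<tau> - m)" "\<tau> \<in> {m<..<b}"
      using eventually_happens trivial_limit_at_right_real by blast
    then have "\<tau> \<in> A" "m < \<tau>"
      using m(1) \<open>a \<le> m\<close> by (auto simp: A_def \<psi>_def algebra_simps)
    then show False using m(2) by force
  qed
  show ?thesis
  proof (rule tendsto_lowerbound)
    show "((\<lambda>\<epsilon>. (c + \<epsilon>) * (b - a)) \<longlongrightarrow> c * (b - a)) (at_right 0)"
      by (auto intro!: tendsto_eq_intros)
    show "\<forall>\<^sub>F \<epsilon> in at_right 0. \<phi> b - \<phi> a \<le> (c + \<epsilon>) * (b - a)"
      using eventually_at_right_less by (rule eventually_mono) (rule *)
  qed simp
qed

section \<open>Comparison functions\<close>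

lemma class_K_inf_zero: "class_K_inf a \<Longrightarrow> a 0 = 0"
  by (simp add: class_K_inf_def)

lemma class_K_inf_less: "class_K_inf a \<Longrightarrow> 0 \<le> s \<Longrightarrow> s < t \<Longrightarrow> a s < a t"
  unfolding class_K_inf_def strict_mono_on_def by auto

lemma class_K_inf_mono: "class_K_inf a \<Longrightarrow> 0 \<le> s \<Longrightarrow> s \<le> t \<Longrightarrow> a s \<le> a t"
  using class_K_inf_less[of a s t] by (cases "s = t") auto

lemma class_K_inf_nonneg: "class_K_inf a \<Longrightarrow> 0 \<le> s \<Longrightarrow> 0 \<le> a s"
  using class_K_inf_mono[of a 0 s] by (simp add: class_K_inf_zero)

lemma class_K_inf_pos: "class_K_inf a \<Longrightarrow> 0 < s \<Longrightarrow> 0 < a s"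
  using class_K_inf_less[of a 0 s] by (simp add: class_K_inf_zero)

lemma class_K_inf_le_imp_le: "class_K_inf a \<Longrightarrow> 0 \<le> t \<Longrightarrow> a s \<le> a t \<Longrightarrow> s \<le> t"
  using class_K_inf_less[of a t s] by (cases "s \<le> t") auto

lemma class_K_inf_small:
  assumes "class_K_inf a" "0 < \<epsilon>"
  obtains s where "0 < s" "a s \<le> \<epsilon>"
proof -
  have "continuous (at 0 within {0..}) a"
    using assms(1) by (simp add: class_K_inf_def continuous_on_eq_continuous_within)
  then obtain \<delta> where \<delta>: "\<delta> > 0" "\<And>s. s \<in> {0..} \<Longrightarrow> dist s 0 < \<delta> \<Longrightarrow> dist (a s) (a 0) < \<epsilon>"
    unfolding continuous_within_eps_delta using assms(2) by blast
  have "a (\<delta> / 2) \<le> \<epsilon>"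
    using \<delta>(2)[of "\<delta> / 2"] \<delta>(1) class_K_inf_zero[OF assms(1)] by (simp add: dist_real_def)
  then show thesis using that[of "\<delta> / 2"] \<open>\<delta> > 0\<close> by simp
qed

lemma class_K_inf_bounded_preimage:
  assumes "class_K_inf a"
  obtains R where "0 < R" "\<And>s. a s \<le> B \<Longrightarrow> s \<le> R"
proof -
  have "eventually (\<lambda>s. B < a s) at_top"
    using assms by (simp add: class_K_inf_def filterlim_at_top_dense)
  then obtain N where N: "\<And>s. s \<ge> N \<Longrightarrow> B < a s" by (auto simp: eventually_at_top_linorder)
  show thesis
  proof
    show "0 < max N 1" by simp
    show "s \<le> max N 1" if "a s \<le> B" for s
      using N[of s] that by (cases "N \<le> s") auto
  qed
qed

text \<open>The order condition controls the ratio only on some \<open>(0, s0)\<close>. On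
  \<open>[s0, S]\<close> monotonicity bounds numerator and denominator separately, so the bound
  extends to every bounded range.\<close>

lemma bigO_at_zero_bound:
  assumes O: "bigO_at_zero a b" and a: "class_K_inf a" and b: "class_K_inf b"
  obtains C where "0 < C" "\<And>s. 0 < s \<Longrightarrow> s \<le> S \<Longrightarrow> a s \<le> C * b s"
proof -
  obtain C0 where "Limsup (at_right 0) (\<lambda>s. ereal (a s / b s)) < ereal C0"
    using ereal_dense2[OF O[unfolded bigO_at_zero_def]] by auto
  then have "eventually (\<lambda>s. ereal (a s / b s) < ereal C0) (at_right 0)"
    by (rule Limsup_lessD)
  then obtain s0 where s0: "s0 > 0" "\<And>s. 0 < s \<Longrightarrow> s < s0 \<Longrightarrow> a s / b s < C0"
    unfolding eventually_at_right_field by auto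
  \<comment> \<open>\<open>C0\<close> serves below \<open>s0\<close> and \<open>a S / b s0\<close>
    from there on; the 1 keeps \<open>C\<close> positive, as \<open>C0\<close> has no sign a
    priori.\<close>
  define C where "C = max (max C0 1) (a S / b s0)"
  have C_pos: "0 < C" by (simp add: C_def less_max_iff_disj)
  show thesis
  proof
    show "0 < C" by fact
    fix s assume s: "0 < s" "s \<le> S"
    have bs: "b s > 0" using b s(1) by (rule class_K_inf_pos)
    show "a s \<le> C * b s"
    proof (cases "s < s0")
      case True
      then have "a s \<le> C0 * b s" using s0(2)[of s] s bs by (simp add: divide_less_eq)
      also have "\<dots> \<le> C * b s" using bs by (intro mult_right_mono) (auto simp: C_def)
      finally show ?thesis .
    next
      case False
      have b0: "b s0 > 0" using b s0(1) by (rule class_K_inf_pos)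
      have "a s \<le> a S" using s by (intro class_K_inf_mono[OF a]) auto
      also have "\<dots> = a S / b s0 * b s0" using b0 by simp
      also have "\<dots> \<le> C * b s"
        using b0 False s0 C_pos by (intro mult_mono class_K_inf_mono[OF b]) (auto simp: C_def)
      finally show ?thesis .
    qed
  qed
qed

section \<open>Maxima and limits on compact intervals\<close>

lemma compact_interval_SUP:
  fixes \<phi> :: "real \<Rightarrow> real"
  assumes "continuous_on {s..t} \<phi>" "s \<le> t"
  obtains m where "s \<le> m" "m \<le> t" "(SUP \<tau>\<in>{s..t}. \<phi> \<tau>) = \<phi> m"
    "\<And>\<tau>. s \<le> \<tau> \<Longrightarrow> \<tau> \<le> t \<Longrightarrow> \<phi> \<tau> \<le> \<phi> m"
proof -
  obtain m where m: "m \<in> {s..t}" "\<And>\<tau>. \<tau> \<in> {s..t} \<Longrightarrow> \<phi> \<tau> \<le> \<phi> m"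
    using continuous_attains_sup[of "{s..t}" \<phi>] assms by auto
  then have "(SUP \<tau>\<in>{s..t}. \<phi> \<tau>) = \<phi> m" by (intro cSup_eq_maximum) auto
  then show thesis using m by (intro that[of m]) auto
qed

text \<open>Carries estimates that hold as long as no event has occurred over to the sampling
  instant itself, where the event condition may already be true.\<close>

lemma closed_interval_le:
  fixes \<phi> \<psi> :: "real \<Rightarrow> real"
  assumes "continuous_on {s..t} \<phi>" "continuous_on {s..t} \<psi>" "s \<le> t" "\<phi> s \<le> \<psi> s"
    and "\<And>\<tau>. s \<le> \<tau> \<Longrightarrow> \<tau> < t \<Longrightarrow> \<phi> \<tau> \<le> \<psi> \<tau>"
  shows "\<phi> t \<le> \<psi> t"
proof (cases "s = t")
  case False
  then have "closure {s..<t} = {s..t}" using assms(3) by simp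
  then have "\<phi> t - \<psi> t \<le> 0"
    using continuous_le_on_closure[of "{s..<t}" "\<lambda>\<tau>. \<phi> \<tau> - \<psi> \<tau>" t 0] assms
    by (auto intro!: continuous_intros)
  then show ?thesis by simp
qed (use assms in simp)

lemma ereal_le_less_trans: "s \<le> t \<Longrightarrow> ereal t < T \<Longrightarrow> ereal s < T"
  by (meson ereal_less_eq(3) le_less_trans)

lemma ereal_less_le_trans: "s < t \<Longrightarrow> ereal t \<le> T \<Longrightarrow> ereal s < T"
  by (meson ereal_less(1) less_ereal.simps(1) less_le_trans)

subsection \<open>Trajectories under constant input\<close>

locale uncertain_system =
  fixes f :: "'x::euclidean_space \<Rightarrow> 'u::euclidean_space \<Rightarrow> 'd::euclidean_space \<Rightarrow> 'x"
    and D :: "'d set"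
  assumes compact_D: "compact D"
    and f_C1: "continuously_differentiable (\<lambda>(x, u, d). f x u d)"
begin

lemma f_continuous: "continuous_on UNIV (\<lambda>(x, u, d). f x u d)"
  using f_C1 unfolding continuously_differentiable_def
  by (meson continuous_at_imp_continuous_on has_derivative_continuous)

text \<open>Compactness of \<open>D\<close> makes \<open>\<eta>\<close> independent of
  \<open>e\<close>. This is essential because a measurable disturbance may jump arbitrarily inside
  \<open>D\<close> near any time.\<close>

lemma f_uniformly_close:
  assumes "0 < \<epsilon>"
  obtains \<eta> where "0 < \<eta>"
    "\<And>z e. dist z x < \<eta> \<Longrightarrow> e \<in> D \<Longrightarrow> norm (f z u e - f x u e) < \<epsilon>"
proof -
  have "uniformly_continuous_on (cball x 1 \<times> {u} \<times> D) (\<lambda>(x, u, d). f x u d)"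
    by (intro compact_uniformly_continuous continuous_on_subset[OF f_continuous] compact_Times
        compact_D) auto
  then obtain \<eta> where \<eta>: "\<eta> > 0"
    "\<And>p q. p \<in> cball x 1 \<times> {u} \<times> D \<Longrightarrow> q \<in> cball x 1 \<times> {u} \<times> D \<Longrightarrow> dist q p < \<eta> \<Longrightarrow>
       dist (case q of (x, u, d) \<Rightarrow> f x u d) (case p of (x, u, d) \<Rightarrow> f x u d) < \<epsilon>"
    unfolding uniformly_continuous_on_def using assms by meson
  show thesis
  proof
    show "0 < min \<eta> 1" using \<eta>(1) by simp
    fix z e assume "dist z x < min \<eta> 1" "e \<in> D"
    then show "norm (f z u e - f x u e) < \<epsilon>"
      using \<eta>(2)[of "(x, u, e)" "(z, u, e)"] by (auto simp: dist_norm norm_Pair norm_minus_commute)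
  qed
qed

text \<open>The derivative is bounded on the compact product of the two balls and \<open>D\<close>;
  the mean value inequality in the convex state ball then gives a Lipschitz constant uniform in
  input and disturbance.\<close>

lemma f_bounded_Lipschitz:
  obtains B L where "0 < B" "0 < L"
    "\<And>x u e. norm x \<le> \<rho> \<Longrightarrow> norm u \<le> G \<Longrightarrow> e \<in> D \<Longrightarrow> norm (f x u e) \<le> B"
    "\<And>x z u e. norm x \<le> \<rho> \<Longrightarrow> norm z \<le> \<rho> \<Longrightarrow> norm u \<le> G \<Longrightarrow> e \<in> D \<Longrightarrow>
       norm (f x u e - f z u e) \<le> L * norm (x - z)"
proof -
  define K where "K = cball (0::'x) \<rho> \<times> cball (0::'u) G \<times> D"
  have "compact K" unfolding K_def by (intro compact_Times compact_D compact_cball)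
  obtain F' where F': "\<And>p. ((\<lambda>(x, u, d). f x u d) has_derivative blinfun_apply (F' p)) (at p)"
    "continuous_on UNIV F'"
    using f_C1 unfolding continuously_differentiable_def by blast
  have "bounded ((\<lambda>(x, u, d). f x u d) ` K)" "bounded (F' ` K)"
    using \<open>compact K\<close> F'(2) f_continuous
    by (auto intro!: compact_imp_bounded compact_continuous_image intro: continuous_on_subset)
  then obtain B L where BL: "0 < B" "0 < L"
    "\<And>p. p \<in> K \<Longrightarrow> norm (case p of (x, u, d) \<Rightarrow> f x u d) \<le> B" "\<And>p. p \<in> K \<Longrightarrow> norm (F' p) \<le> L"
    by (metis (no_types, lifting) bounded_pos image_eqI)
  show thesis
  proof
    fix x :: 'x and u :: 'u and e assume "norm x \<le> \<rho>" "norm u \<le> G" "e \<in> D"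
    then show "norm (f x u e) \<le> B" using BL(3)[of "(x, u, e)"] by (auto simp: K_def)
  next
    fix x z :: 'x and u :: 'u and e assume *: "norm x \<le> \<rho>" "norm z \<le> \<rho>" "norm u \<le> G" "e \<in> D"
    show "norm (f x u e - f z u e) \<le> L * norm (x - z)"
    proof (rule differentiable_bound[where S = "cball 0 \<rho>" and f = "\<lambda>y. f y u e"
          and f' = "\<lambda>y v. blinfun_apply (F' (y, u, e)) (v, 0, 0)"])
      fix y :: 'x assume y: "y \<in> cball 0 \<rho>"
      have "((\<lambda>y. (y, u, e)) has_derivative (\<lambda>v. (v, 0, 0))) (at y within cball 0 \<rho>)"
        by (auto intro!: derivative_eq_intros simp: zero_prod_def)
      from has_derivative_compose[OF this F'(1)]
      show "((\<lambda>y. f y u e) has_derivative (\<lambda>v. blinfun_apply (F' (y, u, e)) (v, 0, 0)))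
          (at y within cball 0 \<rho>)"
        by simp
      have "norm (blinfun_apply (F' (y, u, e)) (v, 0, 0)) \<le> L * norm v" for v :: 'x
      proof -
        have "norm (blinfun_apply (F' (y, u, e)) (v, 0, 0)) \<le> norm (F' (y, u, e)) * norm (v, 0::'u, 0::'d)"
          by (rule norm_blinfun)
        also have "\<dots> \<le> L * norm v"
          using BL(4)[of "(y, u, e)"] y * by (auto simp: K_def norm_Pair intro!: mult_right_mono)
        finally show ?thesis .
      qed
      then show "onorm (\<lambda>v. blinfun_apply (F' (y, u, e)) (v, 0, 0)) \<le> L"
        by (rule onorm_le)
    qed (use * in auto)
  qed (use BL in auto)
qed

text \<open>Caratheodory solution with the input frozen at \<open>u\<close>. It is vacuous for
  \<open>b < a\<close>, so restriction and joining need no hypothesis on the order of the new end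
  points.\<close>

definition hold :: "(real \<Rightarrow> 'd) \<Rightarrow> 'u \<Rightarrow> real \<Rightarrow> real \<Rightarrow> (real \<Rightarrow> 'x) \<Rightarrow> bool" where
  "hold d u a b y \<longleftrightarrow> (\<forall>t\<in>{a..b}. ((\<lambda>\<sigma>. f (y \<sigma>) u (d \<sigma>)) has_integral (y t - y a)) {a..t})"

lemma holdD:
  assumes "hold d u a b y" "a \<le> s" "s \<le> t" "t \<le> b"
  shows "((\<lambda>\<sigma>. f (y \<sigma>) u (d \<sigma>)) has_integral (y t - y s)) {s..t}"
proof -
  have t: "((\<lambda>\<sigma>. f (y \<sigma>) u (d \<sigma>)) has_integral (y t - y a)) {a..t}"
    and s: "((\<lambda>\<sigma>. f (y \<sigma>) u (d \<sigma>)) has_integral (y s - y a)) {a..s}"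
    using assms by (auto simp: hold_def)
  have int: "(\<lambda>\<sigma>. f (y \<sigma>) u (d \<sigma>)) integrable_on {s..t}"
    by (rule integrable_on_subinterval[OF has_integral_integrable[OF t]]) (use assms in auto)
  from has_integral_combine[OF assms(2,3) s integrable_integral[OF int]]
  have "y t - y a = y s - y a + integral {s..t} (\<lambda>\<sigma>. f (y \<sigma>) u (d \<sigma>))"
    by (rule has_integral_unique[OF t])
  then show ?thesis using integrable_integral[OF int] by simp
qed

lemma hold_subinterval: "hold d u a b y \<Longrightarrow> a \<le> a' \<Longrightarrow> b' \<le> b \<Longrightarrow> hold d u a' b' y"
  unfolding hold_def[of d u a' b'] by (auto intro!: holdD)

lemma hold_join:
  assumes "hold d u a b y" "hold d u b c y"
  shows "hold d u a c y"
  unfolding hold_def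
proof
  fix t assume t: "t \<in> {a..c}"
  show "((\<lambda>\<sigma>. f (y \<sigma>) u (d \<sigma>)) has_integral (y t - y a)) {a..t}"
  proof (cases "t \<le> b")
    case True
    then show ?thesis using assms t by (simp add: hold_def)
  next
    case False
    show ?thesis
    proof (cases "a \<le> b")
      case True
      then have *: "((\<lambda>\<sigma>. f (y \<sigma>) u (d \<sigma>)) has_integral (y b - y a)) {a..b}"
        "((\<lambda>\<sigma>. f (y \<sigma>) u (d \<sigma>)) has_integral (y t - y b)) {b..t}"
        using t \<open>\<not> t \<le> b\<close> True holdD[OF assms(1), of a b] holdD[OF assms(2), of b t] by auto
      show ?thesis using has_integral_combine[OF True _ *] \<open>\<not> t \<le> b\<close> by simp
    next
      case False
      then show ?thesis using assms t by (intro holdD[of d u b c]) auto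
    qed
  qed
qed

lemma hold_cong:
  assumes "\<And>t. a \<le> t \<Longrightarrow> t \<le> b \<Longrightarrow> y t = z t"
  shows "hold d u a b y \<longleftrightarrow> hold d u a b z"
proof -
  have "((\<lambda>\<sigma>. f (y \<sigma>) u (d \<sigma>)) has_integral (y t - y a)) {a..t} \<longleftrightarrow>
        ((\<lambda>\<sigma>. f (z \<sigma>) u (d \<sigma>)) has_integral (z t - z a)) {a..t}" if "t \<in> {a..b}" for t
    using that assms by (auto intro!: has_integral_cong)
  then show ?thesis by (simp add: hold_def)
qed

lemma hold_continuous_on:
  assumes "hold d u a b y"
  shows "continuous_on {a..b} y"
proof (cases "a \<le> b")
  case True
  have "continuous_on {a..b} (\<lambda>t. y a + integral {a..t} (\<lambda>\<sigma>. f (y \<sigma>) u (d \<sigma>)))"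
    using assms True unfolding hold_def
    by (intro continuous_intros indefinite_integral_continuous_1) auto
  moreover have "y a + integral {a..t} (\<lambda>\<sigma>. f (y \<sigma>) u (d \<sigma>)) = y t" if "t \<in> {a..b}" for t
    using assms that integral_unique[of "\<lambda>\<sigma>. f (y \<sigma>) u (d \<sigma>)" "y t - y a"] by (auto simp: hold_def)
  ultimately show ?thesis by (rule continuous_on_eq)
qed simp

text \<open>Linearise \<open>\<Phi>\<close> at \<open>y t\<close>. The derivative
  \<open>\<Phi>'\<close> commutes with the integral of \<open>f\<close>, and near \<open>t\<close>
  the integrand is close to \<open>f (y t) u (d \<sigma>)\<close>, for which \<open>le\<close> holds
  whatever the value of the disturbance. Half of \<open>\<epsilon>\<close> pays for this comparison,
  half for the linearisation error.\<close>

lemma hold_right_dini: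
  assumes hold: "hold d u a b y" and t: "a \<le> t" "t < b"
    and d: "\<And>s. a \<le> s \<Longrightarrow> s \<le> b \<Longrightarrow> d s \<in> D"
    and \<Phi>': "(\<Phi> has_derivative \<Phi>') (at (y t))"
    and le: "\<And>e. e \<in> D \<Longrightarrow> \<Phi>' (f (y t) u e) \<le> (c::real)"
    and "0 < \<epsilon>"
  shows "\<forall>\<^sub>F \<tau> in at_right t. \<Phi> (y \<tau>) - \<Phi> (y t) \<le> (c + \<epsilon>) * (\<tau> - t)"
proof -
  interpret \<Phi>': bounded_linear \<Phi>' using \<Phi>' by (rule has_derivative_bounded_linear)
  obtain K where K: "K > 0" "\<And>v. \<bar>\<Phi>' v\<bar> \<le> norm v * K"
    using \<Phi>'.pos_bounded by auto
  obtain B L where B: "0 < B" "\<And>e. e \<in> D \<Longrightarrow> norm (f (y t) u e) \<le> B"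
    using f_bounded_Lipschitz[of "norm (y t)" "norm u"] by (metis order_refl)
  \<comment> \<open>\<open>y\<close> moves with speed at most \<open>B + 1\<close> near
    \<open>t\<close>, so a remainder of \<open>\<epsilon>1 * norm (y \<tau> - y t)\<close> costs at
    most \<open>\<epsilon> / 2\<close> per unit of time.\<close>
  define \<epsilon>1 where "\<epsilon>1 = \<epsilon> / (2 * (B + 1))"
  have \<epsilon>1: "\<epsilon>1 > 0" "\<epsilon>1 * (B + 1) = \<epsilon> / 2" using \<open>\<epsilon> > 0\<close> B(1) by (auto simp: \<epsilon>1_def field_simps)
  obtain \<eta>1 where \<eta>1: "\<eta>1 > 0"
    "\<And>z. norm (z - y t) < \<eta>1 \<Longrightarrow> norm (\<Phi> z - \<Phi> (y t) - \<Phi>' (z - y t)) \<le> \<epsilon>1 * norm (z - y t)"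
    using \<Phi>' \<epsilon>1(1) unfolding has_derivative_at_alt by blast
  \<comment> \<open>The 1 yields the speed bound \<open>B + 1\<close>; the other term keeps the
    error after applying \<open>\<Phi>'\<close> below \<open>\<epsilon> / 2\<close>.\<close>
  have "min 1 (\<epsilon> / (2 * K)) > 0" using \<open>\<epsilon> > 0\<close> K by simp
  then obtain \<eta>2 where \<eta>2: "\<eta>2 > 0"
    "\<And>z e. dist z (y t) < \<eta>2 \<Longrightarrow> e \<in> D \<Longrightarrow> norm (f z u e - f (y t) u e) < min 1 (\<epsilon> / (2 * K))"
    using f_uniformly_close by blast
  have "continuous (at t within {a..b}) y"
    using hold_continuous_on[OF hold] t by (simp add: continuous_on_eq_continuous_within)
  then obtain \<delta> where \<delta>: "\<delta> > 0"
    "\<And>\<tau>. \<tau> \<in> {a..b} \<Longrightarrow> dist \<tau> t < \<delta> \<Longrightarrow> dist (y \<tau>) (y t) < min \<eta>1 \<eta>2"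
    unfolding continuous_within_eps_delta using \<eta>1 \<eta>2 by (metis min_less_iff_conj)
  have "\<forall>\<^sub>F \<tau> in at_right t. \<tau> \<in> {t<..<min b (t + \<delta>)}"
    using t \<delta> by (intro eventually_at_right_real) auto
  then show ?thesis
  proof (rule eventually_mono)
    fix \<tau> assume \<tau>: "\<tau> \<in> {t<..<min b (t + \<delta>)}"
    have close: "dist (y \<sigma>) (y t) < min \<eta>1 \<eta>2" if "\<sigma> \<in> {t..\<tau>}" for \<sigma>
      using that \<tau> t by (intro \<delta>(2)) (auto simp: dist_real_def)
    have int: "((\<lambda>\<sigma>. f (y \<sigma>) u (d \<sigma>)) has_integral (y \<tau> - y t)) {t..\<tau>}"
      using \<tau> t by (intro holdD[OF hold]) auto
    have near: "norm (f (y \<sigma>) u (d \<sigma>) - f (y t) u (d \<sigma>)) < min 1 (\<epsilon> / (2 * K))" if "\<sigma> \<in> {t..\<tau>}" for \<sigma>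
      using close[OF that] that \<tau> t by (intro \<eta>2(2) d) auto
    have dD: "d \<sigma> \<in> D" if "\<sigma> \<in> {t..\<tau>}" for \<sigma> using that \<tau> t by (intro d) auto
    have "norm (f (y \<sigma>) u (d \<sigma>)) \<le> B + 1" if "\<sigma> \<in> {t..\<tau>}" for \<sigma>
      using near[OF that] B(2)[OF dD[OF that]] norm_triangle_sub[of "f (y \<sigma>) u (d \<sigma>)" "f (y t) u (d \<sigma>)"] by simp
    then have growth: "norm (y \<tau> - y t) \<le> (B + 1) * (\<tau> - t)"
      using has_integral_bound[of "B + 1" "\<lambda>\<sigma>. f (y \<sigma>) u (d \<sigma>)" "y \<tau> - y t" t \<tau>] int B(1) \<tau> by auto
    have "\<Phi>' (f (y \<sigma>) u (d \<sigma>)) \<le> c + \<epsilon> / 2" if "\<sigma> \<in> {t..\<tau>}" for \<sigma>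
    proof -
      have "\<bar>\<Phi>' (f (y \<sigma>) u (d \<sigma>) - f (y t) u (d \<sigma>))\<bar> \<le> norm (f (y \<sigma>) u (d \<sigma>) - f (y t) u (d \<sigma>)) * K"
        by (rule K)
      also have "\<dots> \<le> \<epsilon> / (2 * K) * K" using near[OF that] K(1) by (intro mult_right_mono) auto
      also have "\<dots> = \<epsilon> / 2" using K(1) by simp
      finally show ?thesis using le[OF dD[OF that]] unfolding \<Phi>'.diff by linarith
    qed
    then have "\<Phi>' (y \<tau> - y t) \<le> (c + \<epsilon> / 2) * (\<tau> - t)"
      using has_integral_le[OF has_integral_linear[OF int \<Phi>'.bounded_linear_axioms]
          has_integral_const_real[of "c + \<epsilon> / 2" t \<tau>]] \<tau> by (simp add: mult.commute)
    moreover have "\<Phi> (y \<tau>) - \<Phi> (y t) - \<Phi>' (y \<tau> - y t) \<le> \<epsilon>1 * norm (y \<tau> - y t)"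
      using \<eta>1(2)[of "y \<tau>"] close[of \<tau>] \<tau> by (auto simp: dist_norm)
    moreover have "\<epsilon>1 * norm (y \<tau> - y t) \<le> \<epsilon> / 2 * (\<tau> - t)"
      using mult_left_mono[OF growth, of \<epsilon>1] \<epsilon>1 by (simp add: mult.assoc[symmetric])
    ultimately show "\<Phi> (y \<tau>) - \<Phi> (y t) \<le> (c + \<epsilon>) * (\<tau> - t)"
      by (simp add: algebra_simps add_divide_distrib diff_divide_distrib)
  qed
qed

lemma hold_increment_le:
  assumes hold: "hold d u a b y" and "a \<le> b"
    and d: "\<And>s. a \<le> s \<Longrightarrow> s \<le> b \<Longrightarrow> d s \<in> D"
    and \<Phi>: "\<And>t. a \<le> t \<Longrightarrow> t \<le> b \<Longrightarrow> (\<Phi> has_derivative \<Phi>' (y t)) (at (y t))"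
    and le: "\<And>t e. a \<le> t \<Longrightarrow> t < b \<Longrightarrow> e \<in> D \<Longrightarrow> \<Phi>' (y t) (f (y t) u e) \<le> (c::real)"
  shows "\<Phi> (y b) \<le> \<Phi> (y a) + c * (b - a)"
proof -
  have "continuous_on (y ` {a..b}) \<Phi>"
    by (auto intro!: continuous_at_imp_continuous_on has_derivative_continuous \<Phi>)
  then have "continuous_on {a..b} (\<lambda>t. \<Phi> (y t))"
    by (rule continuous_on_compose2[OF _ hold_continuous_on[OF hold]]) auto
  from right_dini_bound[OF \<open>a \<le> b\<close> this, of c]
  have "\<Phi> (y b) - \<Phi> (y a) \<le> c * (b - a)"
    using hold_right_dini[OF hold _ _ d \<Phi> le] by fastforce
  then show ?thesis by simp
qed

lemma hold_integrand_integrable: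
  fixes y :: "real \<Rightarrow> 'x"
  assumes "continuous_on {a..b} y" "d \<in> borel_measurable (lebesgue_on {a..b})"
    and "\<And>t. a \<le> t \<Longrightarrow> t \<le> b \<Longrightarrow> norm (f (y t) u (d t)) \<le> B"
  shows "(\<lambda>\<sigma>. f (y \<sigma>) u (d \<sigma>)) integrable_on {a..b}"
proof -
  have "y \<in> borel_measurable (lebesgue_on {a..b})"
    using assms(1) by (rule continuous_imp_measurable_on_sets_lebesgue) simp
  then have "(\<lambda>\<sigma>. (y \<sigma>, u, d \<sigma>)) \<in> borel_measurable (lebesgue_on {a..b})"
    using assms(2) by (intro borel_measurable_Pair borel_measurable_const)
  from borel_measurable_continuous_on[OF f_continuous this]
  have "(\<lambda>\<sigma>. f (y \<sigma>) u (d \<sigma>)) \<in> borel_measurable (lebesgue_on {a..b})"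
    by simp
  then have "(\<lambda>\<sigma>. f (y \<sigma>) u (d \<sigma>)) absolutely_integrable_on {a..b}"
    by (rule measurable_bounded_by_integrable_imp_absolutely_integrable[where g = "\<lambda>_. B"])
      (use assms(3) in \<open>auto intro: integrable_on_const\<close>)
  then show ?thesis by (simp add: absolutely_integrable_on_def)
qed

text \<open>Picard iteration with a time \<open>\<delta>\<close> that depends only on the bounds
  \<open>G\<close> and \<open>\<rho>\<close>. Existence and uniqueness share this
  \<open>\<delta>\<close>, so a local solution can be identified with an older one on an
  overlap.\<close>

lemma local_hold:
  obtains \<delta> where "0 < \<delta>"
    "\<And>s d u \<xi>. d \<in> borel_measurable (lebesgue_on {s..s + \<delta>}) \<Longrightarrow>
       (\<And>t. s \<le> t \<Longrightarrow> t \<le> s + \<delta> \<Longrightarrow> d t \<in> D) \<Longrightarrow> norm u \<le> G \<Longrightarrow> norm \<xi> \<le> \<rho> \<Longrightarrow>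
       \<exists>y. y s = \<xi> \<and> hold d u s (s + \<delta>) y \<and> (\<forall>t. norm (y t) \<le> \<rho> + 1)"
    "\<And>s t d u y z. hold d u s t y \<Longrightarrow> hold d u s t z \<Longrightarrow> s \<le> t \<Longrightarrow> t \<le> s + \<delta> \<Longrightarrow> y s = z s \<Longrightarrow>
       (\<And>\<sigma>. s \<le> \<sigma> \<Longrightarrow> \<sigma> \<le> t \<Longrightarrow> d \<sigma> \<in> D \<and> norm (y \<sigma>) \<le> \<rho> + 1 \<and> norm (z \<sigma>) \<le> \<rho> + 1) \<Longrightarrow>
       norm u \<le> G \<Longrightarrow> y t = z t"
proof -
  obtain B L where B: "0 < B" "0 < L"
    and fB: "\<And>x u e. norm x \<le> \<rho> + 1 \<Longrightarrow> norm u \<le> G \<Longrightarrow> e \<in> D \<Longrightarrow> norm (f x u e) \<le> B"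
    and fL: "\<And>x z u e. norm x \<le> \<rho> + 1 \<Longrightarrow> norm z \<le> \<rho> + 1 \<Longrightarrow> norm u \<le> G \<Longrightarrow> e \<in> D \<Longrightarrow>
       norm (f x u e - f z u e) \<le> L * norm (x - z)"
    using f_bounded_Lipschitz[of "\<rho> + 1" G] by metis
  \<comment> \<open>The first bound keeps the iterates within distance 1 of the initial state, the
    second makes the Picard operator a contraction with factor 1/2.\<close>
  define \<delta> where "\<delta> = min (1 / B) (1 / (2 * L))"
  have \<delta>: "0 < \<delta>" "B * \<delta> \<le> 1" "L * \<delta> \<le> 1 / 2"
    using B by (auto simp: \<delta>_def min_def field_simps)
  show thesis
  proof
    show "0 < \<delta>" by fact
  next
    fix s d and u :: 'u and \<xi> :: 'x
    assume meas: "d \<in> borel_measurable (lebesgue_on {s..s + \<delta>})"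
      and d: "\<And>t. s \<le> t \<Longrightarrow> t \<le> s + \<delta> \<Longrightarrow> d t \<in> D" and u: "norm u \<le> G" and \<xi>: "norm \<xi> \<le> \<rho>"
    \<comment> \<open>Clamping time to the interval lets the iteration run in the complete space of
      bounded continuous functions on the whole line.\<close>
    define c where "c t = max s (min t (s + \<delta>))" for t
    have c: "s \<le> c t" "c t \<le> s + \<delta>" for t using \<delta>(1) by (auto simp: c_def)
    define S where "S = PiC (UNIV :: real set) (\<lambda>_. cball (0::'x) (\<rho> + 1))"
    have S: "\<phi> \<in> S \<longleftrightarrow> (\<forall>t. norm (apply_bcontfun \<phi> t) \<le> \<rho> + 1)" for \<phi>
      by (auto simp: S_def mem_PiC_iff)
    define I where "I \<phi> t = \<xi> + integral {s..c t} (\<lambda>\<sigma>. f (apply_bcontfun \<phi> \<sigma>) u (d \<sigma>))" for \<phi> t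
    have int: "(\<lambda>\<sigma>. f (apply_bcontfun \<phi> \<sigma>) u (d \<sigma>)) integrable_on {s..c t}" if "\<phi> \<in> S" for \<phi> t
    proof (rule integrable_on_subinterval[of _ "{s..s + \<delta>}"])
      show "(\<lambda>\<sigma>. f (apply_bcontfun \<phi> \<sigma>) u (d \<sigma>)) integrable_on {s..s + \<delta>}"
        using that d u by (intro hold_integrand_integrable[OF _ meas, where B = B] fB) (auto simp: S)
    qed (use c in auto)
    have norm_I: "norm (I \<phi> t - \<xi>) \<le> 1" if "\<phi> \<in> S" for \<phi> t
    proof -
      have "norm (integral {s..c t} (\<lambda>\<sigma>. f (apply_bcontfun \<phi> \<sigma>) u (d \<sigma>))) \<le> B * (c t - s)"
        using has_integral_bound[OF _ integrable_integral[OF int[OF that, of t], unfolded box_real(2)[symmetric]], of B]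
          B c[of t] d u that fB by (auto simp: S)
      also have "\<dots> \<le> B * \<delta>" using B c[of t] by (intro mult_left_mono) auto
      finally show ?thesis using \<delta> by (simp add: I_def)
    qed
    have I_S: "norm (I \<phi> t) \<le> \<rho> + 1" if "\<phi> \<in> S" for \<phi> t
      using norm_I[OF that, of t] \<xi> norm_triangle_sub[of "I \<phi> t" \<xi>] by simp
    have "continuous_on UNIV (I \<phi>)" if "\<phi> \<in> S" for \<phi>
    proof -
      have "continuous_on {s..s + \<delta>} (\<lambda>t. integral {s..t} (\<lambda>\<sigma>. f (apply_bcontfun \<phi> \<sigma>) u (d \<sigma>)))"
        using int[OF that, of "s + \<delta>"] \<delta>(1) by (intro indefinite_integral_continuous_1) (simp add: c_def)
      moreover have "continuous_on UNIV c" unfolding c_def by (intro continuous_intros)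
      ultimately have "continuous_on UNIV (\<lambda>t. integral {s..c t} (\<lambda>\<sigma>. f (apply_bcontfun \<phi> \<sigma>) u (d \<sigma>)))"
        by (rule continuous_on_compose2) (use c in auto)
      then show ?thesis unfolding I_def by (intro continuous_intros)
    qed
    then have "I \<phi> \<in> bcontfun" if "\<phi> \<in> S" for \<phi>
      using that I_S by (intro bcontfun_normI) auto
    then have apply_I: "apply_bcontfun (Bcontfun (I \<phi>)) = I \<phi>" if "\<phi> \<in> S" for \<phi>
      using that by (simp add: Bcontfun_inverse)
    have "\<exists>!\<phi>\<in>S. Bcontfun (I \<phi>) = \<phi>"
    proof (rule Banach_fix)
      show "complete S" unfolding S_def complete_eq_closed by (rule closed_PiC) auto
      have "const_bcontfun \<xi> \<in> S" using \<xi> by (simp add: S const_bcontfun.rep_eq)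
      then show "S \<noteq> {}" by blast
      show "(\<lambda>\<phi>. Bcontfun (I \<phi>)) ` S \<subseteq> S"
        using I_S apply_I S by auto
      fix \<phi> \<psi> assume \<phi>: "\<phi> \<in> S" and \<psi>: "\<psi> \<in> S"
      show "dist (Bcontfun (I \<phi>)) (Bcontfun (I \<psi>)) \<le> 1 / 2 * dist \<phi> \<psi>"
      proof (rule dist_bound)
        fix t
        let ?g = "\<lambda>\<sigma>. f (apply_bcontfun \<phi> \<sigma>) u (d \<sigma>) - f (apply_bcontfun \<psi> \<sigma>) u (d \<sigma>)"
        have "norm (?g \<sigma>) \<le> L * dist \<phi> \<psi>" if "\<sigma> \<in> {s..c t}" for \<sigma>
        proof -
          have "norm (?g \<sigma>) \<le> L * norm (apply_bcontfun \<phi> \<sigma> - apply_bcontfun \<psi> \<sigma>)"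
            using that \<phi> \<psi> u c[of t] by (intro fL d) (auto simp: S)
          also have "\<dots> \<le> L * dist \<phi> \<psi>"
            using dist_bounded[of \<phi> \<sigma> \<psi>] B by (intro mult_left_mono) (auto simp: dist_norm)
          finally show ?thesis .
        qed
        then have "norm (integral {s..c t} ?g) \<le> L * dist \<phi> \<psi> * (c t - s)"
          using has_integral_bound[OF _ integrable_integral[OF integrable_diff[OF int[OF \<phi>, of t] int[OF \<psi>, of t]],
                unfolded box_real(2)[symmetric]], of "L * dist \<phi> \<psi>"] B c[of t] by auto
        also have "\<dots> \<le> L * dist \<phi> \<psi> * \<delta>" using B c[of t] by (intro mult_left_mono) auto
        also have "\<dots> = L * \<delta> * dist \<phi> \<psi>" by simp
        also have "\<dots> \<le> 1 / 2 * dist \<phi> \<psi>" using \<delta> by (intro mult_right_mono) auto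
        finally show "dist (apply_bcontfun (Bcontfun (I \<phi>)) t) (apply_bcontfun (Bcontfun (I \<psi>)) t) \<le> 1 / 2 * dist \<phi> \<psi>"
          using apply_I \<phi> \<psi> int by (simp add: I_def dist_norm integral_diff)
      qed
    qed auto
    then obtain \<phi> where \<phi>: "\<phi> \<in> S" "Bcontfun (I \<phi>) = \<phi>" by blast
    have eq: "apply_bcontfun \<phi> t = \<xi> + integral {s..c t} (\<lambda>\<sigma>. f (apply_bcontfun \<phi> \<sigma>) u (d \<sigma>))" for t
      using apply_I[OF \<phi>(1)] \<phi>(2) by (metis I_def)
    have start: "apply_bcontfun \<phi> s = \<xi>" using eq[of s] \<delta>(1) by (simp add: c_def)
    moreover have "hold d u s (s + \<delta>) (apply_bcontfun \<phi>)"
      unfolding hold_def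
    proof
      fix t assume "t \<in> {s..s + \<delta>}"
      then have "c t = t" by (simp add: c_def)
      then show "((\<lambda>\<sigma>. f (apply_bcontfun \<phi> \<sigma>) u (d \<sigma>)) has_integral apply_bcontfun \<phi> t - apply_bcontfun \<phi> s) {s..t}"
        using integrable_integral[OF int[OF \<phi>(1), of t]] eq[of t] start by simp
    qed
    ultimately show "\<exists>y. y s = \<xi> \<and> hold d u s (s + \<delta>) y \<and> (\<forall>t. norm (y t) \<le> \<rho> + 1)"
      using \<phi>(1) S by blast
  next
    fix s t d and u :: 'u and y z
    assume y: "hold d u s t y" and z: "hold d u s t z" and st: "s \<le> t" "t \<le> s + \<delta>" and "y s = z s"
      and b: "\<And>\<sigma>. s \<le> \<sigma> \<Longrightarrow> \<sigma> \<le> t \<Longrightarrow> d \<sigma> \<in> D \<and> norm (y \<sigma>) \<le> \<rho> + 1 \<and> norm (z \<sigma>) \<le> \<rho> + 1"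
      and u: "norm u \<le> G"
    have "continuous_on {s..t} (\<lambda>\<sigma>. norm (y \<sigma> - z \<sigma>))"
      by (intro continuous_intros hold_continuous_on[OF y] hold_continuous_on[OF z])
    then obtain m where m: "m \<in> {s..t}" "\<And>\<sigma>. \<sigma> \<in> {s..t} \<Longrightarrow> norm (y \<sigma> - z \<sigma>) \<le> norm (y m - z m)"
      using continuous_attains_sup[of "{s..t}" "\<lambda>\<sigma>. norm (y \<sigma> - z \<sigma>)"] st by auto
    \<comment> \<open>The largest distance \<open>M\<close> of the two solutions is attained at
      \<open>m\<close>. Integrating up to \<open>m\<close> gives
      \<open>M \<le> M / 2\<close>.\<close>
    define M where "M = norm (y m - z m)"
    have "norm (f (y \<sigma>) u (d \<sigma>) - f (z \<sigma>) u (d \<sigma>)) \<le> L * M" if "\<sigma> \<in> {s..m}" for \<sigma>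
    proof -
      have "norm (f (y \<sigma>) u (d \<sigma>) - f (z \<sigma>) u (d \<sigma>)) \<le> L * norm (y \<sigma> - z \<sigma>)"
        using that m(1) u b[of \<sigma>] by (intro fL) auto
      also have "\<dots> \<le> L * M" using m(2)[of \<sigma>] that m(1) B by (auto simp: M_def)
      finally show ?thesis .
    qed
    moreover have "((\<lambda>\<sigma>. f (y \<sigma>) u (d \<sigma>) - f (z \<sigma>) u (d \<sigma>)) has_integral (y m - z m)) {s..m}"
      using has_integral_diff[OF holdD[OF y, of s m] holdD[OF z, of s m]] m(1) \<open>y s = z s\<close> by simp
    ultimately have "M \<le> L * M * (m - s)"
      using has_integral_bound[of "L * M" "\<lambda>\<sigma>. f (y \<sigma>) u (d \<sigma>) - f (z \<sigma>) u (d \<sigma>)" "y m - z m" s m] B m(1)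
      by (auto simp: M_def)
    also have "\<dots> \<le> L * M * \<delta>" using m(1) st B by (intro mult_left_mono) (auto simp: M_def)
    also have "\<dots> = L * \<delta> * M" by simp
    also have "\<dots> \<le> 1 / 2 * M" using \<delta>(3) by (rule mult_right_mono) (simp add: M_def)
    finally have "M \<le> 0" by simp
    then show "y t = z t" using m(2)[of t] st by (simp add: M_def)
  qed
qed

end

subsection \<open>Dissipation and dwell time of a sampling interval\<close>

text \<open>\<open>V\<close>, \<open>\<alpha>\<close> and \<open>\<sigma>\<close> stand for
  \<open>V_q\<close>, \<open>\<alpha>_q\<close> and \<open>\<sigma>_q\<close> of the theorem.
  \<open>\<gamma>_ge\<close> results from eliminating \<open>\<alpha>w_hat\<close> between the lower
  bound for it and the lower bound for \<open>\<gamma>\<close>.\<close>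

locale event_triggered_loop = uncertain_system f D
  for f :: "'x::euclidean_space \<Rightarrow> 'u::euclidean_space \<Rightarrow> 'd::euclidean_space \<Rightarrow> 'x"
    and D :: "'d set" +
  fixes g :: "'x \<Rightarrow> 'u"
    and V :: "'x \<Rightarrow> real" and \<alpha>_lo \<alpha>_hi \<alpha> \<sigma> :: "real \<Rightarrow> real"
    and U :: "'u \<Rightarrow> real" and \<alpha>w_lo \<alpha>w_hi \<alpha>w \<sigma>w \<gamma> :: "real \<Rightarrow> real"
  assumes g_differentiable: "g differentiable (at x)"
    and Lyapunov: "ISS_Lyapunov V \<alpha>_lo \<alpha>_hi \<alpha> \<sigma> (f_c f g) D"
    and growth: "error_growth U \<alpha>w_lo \<alpha>w_hi \<alpha>w \<sigma>w (psi f g) D"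
    and K_\<gamma>: "class_K_inf \<gamma>"
    and \<sigma>w_le: "0 \<le> s \<Longrightarrow> 2 * \<sigma>w s \<le> \<alpha> s"
    and \<gamma>_ge: "0 \<le> s \<Longrightarrow> \<sigma> s + 2 * \<alpha>w s \<le> 2 * \<gamma> s"
    and \<gamma>_bigO: "bigO_at_zero \<gamma> \<alpha>w_lo"
begin

lemma class_K:
  "class_K_inf \<alpha>_lo" "class_K_inf \<alpha>_hi" "class_K_inf \<alpha>" "class_K_inf \<sigma>"
  "class_K_inf \<alpha>w_lo" "class_K_inf \<alpha>w_hi" "class_K_inf \<alpha>w" "class_K_inf \<sigma>w"
  using Lyapunov growth by (auto simp: ISS_Lyapunov_def error_growth_def)

lemma V_bounds: "\<alpha>_lo (norm x) \<le> V x" "V x \<le> \<alpha>_hi (norm x)"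
  using Lyapunov by (auto simp: ISS_Lyapunov_def)

lemma U_bounds: "\<alpha>w_lo (norm w) \<le> U w" "U w \<le> \<alpha>w_hi (norm w)"
  using growth by (auto simp: error_growth_def)

lemma U_zero: "U 0 = 0"
  using U_bounds[of 0] class_K by (simp add: class_K_inf_zero)

lemma V_derivative: "(V has_derivative frechet_derivative V (at x)) (at x)"
  using Lyapunov unfolding ISS_Lyapunov_def continuously_differentiable_def
  by (metis frechet_derivative_at)

lemma U_derivative: "(U has_derivative frechet_derivative U (at w)) (at w)"
  using growth unfolding error_growth_def continuously_differentiable_def
  by (metis frechet_derivative_at)

lemma g_derivative: "(g has_derivative frechet_derivative g (at x)) (at x)"
  using g_differentiable frechet_derivative_works by blast

lemma V_continuous: "continuous_on A V"
  by (meson V_derivative continuous_at_imp_continuous_on has_derivative_continuous)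

lemma U_continuous: "continuous_on A U"
  by (meson U_derivative continuous_at_imp_continuous_on has_derivative_continuous)

lemma g_continuous: "continuous_on A g"
  by (meson g_derivative continuous_at_imp_continuous_on has_derivative_continuous)

lemma V_along: "continuous_on A y \<Longrightarrow> continuous_on A (\<lambda>t. V (y t))"
  by (rule continuous_on_compose2[OF V_continuous]) auto

lemma sampling_error_continuous:
  "continuous_on A y \<Longrightarrow> continuous_on A (sampling_error g y s)"
  unfolding sampling_error_def
  by (intro continuous_intros continuous_on_compose2[OF g_continuous[of UNIV]]) auto

lemma sampling_error_start [simp]: "sampling_error g y s s = 0"
  by (simp add: sampling_error_def)

lemma sup_error:
  assumes "continuous_on {s..t} y" "s \<le> t"
  obtains m where "s \<le> m" "m \<le> t"
    "sup_norm_on s t (sampling_error g y s) = norm (sampling_error g y s m)"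
    "\<And>\<tau>. s \<le> \<tau> \<Longrightarrow> \<tau> \<le> t \<Longrightarrow> norm (sampling_error g y s \<tau>) \<le> norm (sampling_error g y s m)"
  unfolding sup_norm_on_def
  by (rule compact_interval_SUP[of s t "\<lambda>\<tau>. norm (sampling_error g y s \<tau>)"])
    (use assms in \<open>auto intro!: continuous_intros sampling_error_continuous\<close>)

lemma sup_error_upper:
  assumes "continuous_on {s..t} y" "s \<le> \<tau>" "\<tau> \<le> t"
  shows "norm (sampling_error g y s \<tau>) \<le> sup_norm_on s t (sampling_error g y s)"
proof -
  have "s \<le> t" using assms by simp
  from sup_error[OF assms(1) this] show ?thesis using assms(2,3) by metis
qed

lemma max_U:
  assumes "continuous_on {s..t} y" "s \<le> t"
  obtains m where "s \<le> m" "m \<le> t"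
    "(SUP \<tau>\<in>{s..t}. U (sampling_error g y s \<tau>)) = U (sampling_error g y s m)"
    "\<And>\<tau>. s \<le> \<tau> \<Longrightarrow> \<tau> \<le> t \<Longrightarrow> U (sampling_error g y s \<tau>) \<le> U (sampling_error g y s m)"
  by (rule compact_interval_SUP[of s t "\<lambda>\<tau>. U (sampling_error g y s \<tau>)"])
    (use assms in \<open>auto intro!: continuous_on_compose2[OF U_continuous[of UNIV]] sampling_error_continuous\<close>)

lemma f_c_sampling_error: "f_c f g (y t) (sampling_error g y s t) e = f (y t) (g (y s)) e"
  by (simp add: f_c_def sampling_error_def)

lemma V_rate:
  "e \<in> D \<Longrightarrow> frechet_derivative V (at (y t)) (f (y t) (g (y s)) e)
     \<le> - \<alpha> (norm (y t)) + \<sigma> (norm (sampling_error g y s t))"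
  using Lyapunov f_c_sampling_error[of y t s e] unfolding ISS_Lyapunov_def by metis

lemma U_rate:
  "e \<in> D \<Longrightarrow> frechet_derivative U (at (sampling_error g y s t))
       (- frechet_derivative g (at (y t)) (f (y t) (g (y s)) e))
     \<le> \<alpha>w (norm (sampling_error g y s t)) + \<sigma>w (norm (y t))"
  using growth f_c_sampling_error[of y t s e] unfolding error_growth_def psi_def by metis

section \<open>Growth of \<open>V\<close> and of \<open>V + 2 U\<close> on a part
  \<open>[a, b]\<close> of a sampling interval, the error being measured from its start
  \<open>s\<close>\<close>

context
  fixes d y s t a b S
  assumes hold: "hold d (g (y s)) s t y" and order: "s \<le> a" "a \<le> b" "b \<le> t"
    and d: "\<And>\<tau>. s \<le> \<tau> \<Longrightarrow> \<tau> \<le> t \<Longrightarrow> d \<tau> \<in> D"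
    and S: "\<And>\<tau>. a \<le> \<tau> \<Longrightarrow> \<tau> \<le> b \<Longrightarrow> norm (sampling_error g y s \<tau>) \<le> S"
begin

lemma S_nonneg: "0 \<le> S"
  using S[of a] order norm_ge_zero order_trans by blast

text \<open>The rate \<open>c\<close> may be negative: \<open>hold_V_increment\<close> takes
  \<open>- 2 \<gamma>(S)\<close>, while \<open>nonevent_decay\<close> uses a positive rate.\<close>

lemma hold_V_decay:
  assumes c: "\<And>\<tau>. a \<le> \<tau> \<Longrightarrow> \<tau> \<le> b \<Longrightarrow> c \<le> \<alpha> (norm (y \<tau>)) - \<sigma> S"
  shows "V (y b) \<le> V (y a) - c * (b - a)"
proof -
  have "V (y b) \<le> V (y a) + (- c) * (b - a)"
  proof (rule hold_increment_le[OF hold_subinterval[OF hold]])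
    show "(V has_derivative frechet_derivative V (at (y \<tau>))) (at (y \<tau>))" for \<tau>
      by (rule V_derivative)
    fix \<tau> e assume \<tau>: "a \<le> \<tau>" "\<tau> < b" and e: "e \<in> D"
    have "\<sigma> (norm (sampling_error g y s \<tau>)) \<le> \<sigma> S"
      using S[of \<tau>] \<tau> by (intro class_K_inf_mono[OF class_K(4)]) auto
    then show "frechet_derivative V (at (y \<tau>)) (f (y \<tau>) (g (y s)) e) \<le> - c"
      using V_rate[OF e, of y \<tau> s] c[of \<tau>] \<tau> by simp
  qed (use order d in auto)
  then show ?thesis by simp
qed

lemma hold_V_increment: "V (y b) \<le> V (y a) + 2 * \<gamma> S * (b - a)"
  using hold_V_decay[of "- (2 * \<gamma> S)"] \<gamma>_ge[OF S_nonneg] class_K_inf_nonneg[OF class_K(7) S_nonneg]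
    class_K_inf_nonneg[OF class_K(3) norm_ge_zero, of "y _"] by (smt (verit) mult_minus_left)

text \<open>The rates add up to \<open>- \<alpha> + 2 \<sigma>w\<close> in the norm of the state,
  which is nonpositive by \<open>\<sigma>w_le\<close>, and to \<open>\<sigma> + 2 \<alpha>w\<close>
  in the norm of the error, which is at most \<open>2 \<gamma>\<close> by
  \<open>\<gamma>_ge\<close>. So the weight 2 on \<open>U\<close> is the one that the dissipation of
  \<open>V\<close> can absorb.\<close>

lemma hold_VU_increment:
  "V (y b) + 2 * U (sampling_error g y s b)
     \<le> V (y a) + 2 * U (sampling_error g y s a) + 2 * \<gamma> S * (b - a)"
proof -
  define \<Phi> where "\<Phi> x = V x + 2 * U (g (y s) - g x)" for x
  have "\<Phi> (y b) \<le> \<Phi> (y a) + (2 * \<gamma> S) * (b - a)"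
  proof (rule hold_increment_le[OF hold_subinterval[OF hold], where \<Phi>' = "\<lambda>x v. frechet_derivative V (at x) v
        + 2 * frechet_derivative U (at (g (y s) - g x)) (- frechet_derivative g (at x) v)"])
    have "((\<lambda>x. g (y s) - g x) has_derivative (\<lambda>v. - frechet_derivative g (at x) v)) (at x)" for x
      by (rule has_derivative_eq_rhs[OF has_derivative_diff[OF has_derivative_const g_derivative]]) simp
    from has_derivative_compose[OF this U_derivative]
    show "(\<Phi> has_derivative (\<lambda>v. frechet_derivative V (at (y \<tau>)) v
        + 2 * frechet_derivative U (at (g (y s) - g (y \<tau>))) (- frechet_derivative g (at (y \<tau>)) v)))
        (at (y \<tau>))" for \<tau>
      unfolding \<Phi>_def by (intro has_derivative_add V_derivative has_derivative_mult_right)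
    fix \<tau> e assume \<tau>: "a \<le> \<tau>" "\<tau> < b" and e: "e \<in> D"
    let ?w = "norm (sampling_error g y s \<tau>)"
    have "\<gamma> ?w \<le> \<gamma> S" using S[of \<tau>] \<tau> by (intro class_K_inf_mono[OF K_\<gamma>]) auto
    then show "frechet_derivative V (at (y \<tau>)) (f (y \<tau>) (g (y s)) e)
        + 2 * frechet_derivative U (at (g (y s) - g (y \<tau>)))
          (- frechet_derivative g (at (y \<tau>)) (f (y \<tau>) (g (y s)) e)) \<le> 2 * \<gamma> S"
      using V_rate[OF e, of y \<tau> s] U_rate[OF e, of y s \<tau>] \<sigma>w_le[of "norm (y \<tau>)"] \<gamma>_ge[of ?w]
      by (simp add: sampling_error_def)
  qed (use order d in auto)
  then show ?thesis by (simp add: \<Phi>_def sampling_error_def)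
qed

end

text \<open>Adding the growth of \<open>V + 2 U\<close> up to the maximiser \<open>m\<close> of
  \<open>U\<close> to the growth of \<open>V\<close> from \<open>m\<close> to \<open>t\<close> gives
  a gain of at most \<open>2 (t - s) \<gamma>(S)\<close>, minus twice the maximum of
  \<open>U\<close>. Without event this maximum exceeds \<open>2 (t - s) \<gamma>(S)\<close>, so
  twice the possible gain is subtracted. For \<open>S = 0\<close> the event is blocked by its second
  clause, and \<open>\<gamma> 0 = 0\<close> gives the claim.\<close>

lemma nonevent_decrease:
  assumes hold: "hold d (g (y s)) s t y" and "s \<le> t"
    and d: "\<And>\<tau>. s \<le> \<tau> \<Longrightarrow> \<tau> \<le> t \<Longrightarrow> d \<tau> \<in> D"
    and "\<not> event \<gamma> U g y s t"
  shows "V (y t) \<le> V (y s) - 2 * (t - s) * \<gamma> (sup_norm_on s t (sampling_error g y s))"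
proof -
  define S where "S = sup_norm_on s t (sampling_error g y s)"
  have cont: "continuous_on {s..t} y" by (rule hold_continuous_on[OF hold])
  have S: "norm (sampling_error g y s \<tau>) \<le> S" if "s \<le> \<tau>" "\<tau> \<le> t" for \<tau>
    unfolding S_def using cont that by (rule sup_error_upper)
  show ?thesis
  proof (cases "S = 0")
    case True
    then show ?thesis
      using hold_V_increment[OF hold _ _ _ d, of s t S] S \<open>s \<le> t\<close> K_\<gamma>
      by (simp add: S_def[symmetric] class_K_inf_zero)
  next
    case False
    obtain m where m: "s \<le> m" "m \<le> t"
      "(SUP \<tau>\<in>{s..t}. U (sampling_error g y s \<tau>)) = U (sampling_error g y s m)"
      using max_U[OF cont \<open>s \<le> t\<close>] by metis
    have "2 * (t - s) * \<gamma> S < U (sampling_error g y s m)"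
      using assms(4) False m(3) by (simp add: event_def S_def)
    moreover have "V (y m) + 2 * U (sampling_error g y s m) \<le> V (y s) + 2 * \<gamma> S * (m - s)"
      using hold_VU_increment[OF hold _ _ _ d, of s m S] S m by (simp add: U_zero)
    moreover have "V (y t) \<le> V (y m) + 2 * \<gamma> S * (t - m)"
      using hold_V_increment[OF hold _ _ _ d, of m t S] S m by simp
    ultimately show ?thesis by (simp add: S_def[symmetric] algebra_simps)
  qed
qed

lemma nonevent_V_le:
  assumes "hold d (g (y s)) s t y" "s \<le> t" "\<And>\<tau>. s \<le> \<tau> \<Longrightarrow> \<tau> \<le> t \<Longrightarrow> d \<tau> \<in> D"
    and "\<not> event \<gamma> U g y s t"
  shows "V (y t) \<le> V (y s)"
proof -
  have "0 \<le> sup_norm_on s t (sampling_error g y s)"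
    using sup_error_upper[OF hold_continuous_on[OF assms(1)], of s] assms(2) by simp
  then have "0 \<le> 2 * (t - s) * \<gamma> (sup_norm_on s t (sampling_error g y s))"
    using K_\<gamma> assms(2) by (simp add: class_K_inf_nonneg)
  then show ?thesis using nonevent_decrease[OF assms] by simp
qed

text \<open>If the error has reached \<open>w0\<close>, \<open>nonevent_decrease\<close> gives the
  rate \<open>2 \<gamma>(w0)\<close>. Otherwise the error stays below \<open>w0\<close>, and
  \<open>V\<close> decreases at rate \<open>c\<close> wherever it is at least \<open>v\<close>; once
  at or below \<open>v\<close> it cannot climb above that level again.\<close>

lemma nonevent_decay:
  assumes hold: "hold d (g (y s)) s t y" and "s \<le> t"
    and d: "\<And>\<tau>. s \<le> \<tau> \<Longrightarrow> \<tau> \<le> t \<Longrightarrow> d \<tau> \<in> D"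
    and nonevent: "\<not> event \<gamma> U g y s t"
    and w0: "0 < w0" and c: "0 < c" "\<And>x. v \<le> V x \<Longrightarrow> c \<le> \<alpha> (norm x) - \<sigma> w0"
  shows "V (y t) \<le> max v (V (y s) - min c (2 * \<gamma> w0) * (t - s))"
proof -
  define S where "S = sup_norm_on s t (sampling_error g y s)"
  have cont: "continuous_on {s..t} y" by (rule hold_continuous_on[OF hold])
  have S: "norm (sampling_error g y s \<tau>) \<le> S" if "s \<le> \<tau>" "\<tau> \<le> t" for \<tau>
    unfolding S_def using cont that by (rule sup_error_upper)
  have c_le: "min c (2 * \<gamma> w0) * (t - s) \<le> c * (t - s)"
    using \<open>s \<le> t\<close> by (intro mult_right_mono) auto
  show ?thesis
  proof (cases "w0 \<le> S")
    case True
    have "min c (2 * \<gamma> w0) * (t - s) \<le> (2 * \<gamma> S) * (t - s)"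
      using class_K_inf_mono[OF K_\<gamma> _ True] w0 \<open>s \<le> t\<close> by (intro mult_right_mono) auto
    then show ?thesis
      using nonevent_decrease[OF hold \<open>s \<le> t\<close> d nonevent] by (simp add: S_def[symmetric] algebra_simps)
  next
    case False
    have decay: "V (y t) \<le> V (y \<tau>) - c * (t - \<tau>)"
      if "s \<le> \<tau>" "\<tau> \<le> t" "\<And>\<tau>'. \<tau> \<le> \<tau>' \<Longrightarrow> \<tau>' \<le> t \<Longrightarrow> v \<le> V (y \<tau>')" for \<tau>
    proof (rule hold_V_decay[OF hold, where S = w0])
      show "norm (sampling_error g y s \<tau>') \<le> w0" if "\<tau> \<le> \<tau>'" "\<tau>' \<le> t" for \<tau>'
        using S[of \<tau>'] that \<open>s \<le> \<tau>\<close> False by simp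
    qed (use that c(2) d in auto)
    define A where "A = {\<tau> \<in> {s..t}. V (y \<tau>) \<le> v}"
    have "closed A"
      unfolding A_def by (intro continuous_on_closed_Collect_le continuous_intros V_along cont)
    moreover have "A \<subseteq> {s..t}" by (auto simp: A_def)
    ultimately have "compact A" by (rule compact_Icc_subset)
    show ?thesis
    proof (cases "A = {}")
      case True
      then have "V (y t) \<le> V (y s) - c * (t - s)"
      proof (intro decay)
        show "v \<le> V (y \<tau>)" if "s \<le> \<tau>" "\<tau> \<le> t" for \<tau>
        proof -
          have "\<tau> \<notin> A" using True by simp
          then show ?thesis using that by (simp add: A_def)
        qed
      qed (use \<open>s \<le> t\<close> in auto)
      then show ?thesis using c_le by simp
    next
      case False
      then obtain m where m: "m \<in> A" "\<And>\<tau>. \<tau> \<in> A \<Longrightarrow> \<tau> \<le> m"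
        using compact_attains_sup[OF \<open>compact A\<close>] by blast
      \<comment> \<open>Otherwise \<open>V\<close> equals \<open>v\<close> at the last time
        \<open>m\<close> with \<open>V \<le> v\<close>, by the intermediate value theorem, and lies
        above \<open>v\<close> afterwards, where it decreases.\<close>
      have "V (y t) \<le> v"
      proof (rule ccontr)
        assume gt: "\<not> V (y t) \<le> v"
        have "\<exists>\<tau>\<ge>m. \<tau> \<le> t \<and> V (y \<tau>) = v"
          using m(1) gt by (intro IVT' continuous_on_subset[OF V_along[OF cont]]) (auto simp: A_def)
        then obtain \<tau> where \<tau>: "m \<le> \<tau>" "\<tau> \<le> t" "V (y \<tau>) = v" by blast
        then have "\<tau> \<in> A" using m(1) by (simp add: A_def)
        then have "V (y m) = v" using m(2)[of \<tau>] \<tau> by simp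
        have later: "v \<le> V (y \<tau>)" if "m < \<tau>" "\<tau> \<le> t" for \<tau>
        proof -
          have "\<tau> \<notin> A" using m(2)[of \<tau>] that(1) by auto
          then show ?thesis using m(1) that by (simp add: A_def)
        qed
        have "V (y t) \<le> V (y m) - c * (t - m)"
        proof (intro decay)
          show "v \<le> V (y \<tau>)" if "m \<le> \<tau>" "\<tau> \<le> t" for \<tau>
            using that \<open>V (y m) = v\<close> later[of \<tau>]
            by (cases "m = \<tau>") auto
        qed (use m(1) in \<open>auto simp: A_def\<close>)
        moreover have "0 \<le> c * (t - m)" using m(1) c(1) by (simp add: A_def)
        moreover have "V (y m) \<le> v" by (simp add: \<open>V (y m) = v\<close>)
        ultimately show False using gt by simp
      qed
      then show ?thesis by simp
    qed
  qed
qed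

text \<open>\<open>V x \<ge> v\<close> keeps \<open>x\<close> outside a ball of radius
  \<open>r\<close>. Half of the dissipation \<open>\<alpha> r\<close> is reserved for the error
  term, the other half is the rate \<open>c\<close>.\<close>

lemma level_constants:
  assumes "0 < v"
  obtains c w0 where "0 < c" "0 < w0" "\<And>x. v \<le> V x \<Longrightarrow> c \<le> \<alpha> (norm x) - \<sigma> w0"
proof -
  obtain r where r: "0 < r" "\<alpha>_hi r \<le> v" using class_K_inf_small[OF class_K(2) assms] .
  have "\<alpha> r / 2 > 0" using class_K_inf_pos[OF class_K(3) r(1)] by simp
  then obtain w0 where w0: "0 < w0" "\<sigma> w0 \<le> \<alpha> r / 2" using class_K_inf_small[OF class_K(4)] by blast
  show thesis
  proof
    show "\<alpha> r / 2 > 0" "0 < w0" by fact+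
    fix x assume "v \<le> V x"
    then have "\<alpha>_hi r \<le> \<alpha>_hi (norm x)" using r(2) V_bounds(2)[of x] by simp
    then have "r \<le> norm x" by (rule class_K_inf_le_imp_le[OF class_K(2) norm_ge_zero])
    then have "\<alpha> r \<le> \<alpha> (norm x)" using r(1) by (intro class_K_inf_mono[OF class_K(3)]) auto
    then show "\<alpha> r / 2 \<le> \<alpha> (norm x) - \<sigma> w0" using w0 by simp
  qed
qed

section \<open>Events along continuous curves: minimal delay and attainment of the infimum\<close>

lemma g_bounded:
  obtains G where "\<And>x. norm x \<le> \<rho> \<Longrightarrow> norm (g x) \<le> G"
proof -
  have "bounded (g ` cball 0 \<rho>)"
    by (intro compact_imp_bounded compact_continuous_image g_continuous compact_cball)
  then show thesis using that unfolding bounded_iff by (metis image_eqI mem_cball_0)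
qed

text \<open>With \<open>S > 0\<close> the largest error, an event forces
  \<open>\<alpha>w_lo(S) \<le> 2 (t - s) \<gamma>(S)\<close>, whereas
  \<open>\<gamma>(S) \<le> C * \<alpha>w_lo(S)\<close>. One constant \<open>C\<close> serves because
  errors in the ball are at most \<open>2 * G\<close>. Only continuity and boundedness of the curve
  enter.\<close>

lemma dwell_time:
  obtains \<delta> where "0 < \<delta>"
    "\<And>y s t. continuous_on {s..t} y \<Longrightarrow> s \<le> t \<Longrightarrow> (\<And>\<tau>. s \<le> \<tau> \<Longrightarrow> \<tau> \<le> t \<Longrightarrow> norm (y \<tau>) \<le> \<rho>) \<Longrightarrow>
       event \<gamma> U g y s t \<Longrightarrow> s + \<delta> \<le> t"
proof -
  obtain G where G: "\<And>x. norm x \<le> \<rho> \<Longrightarrow> norm (g x) \<le> G" using g_bounded by blast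
  obtain C where C: "0 < C" "\<And>s. 0 < s \<Longrightarrow> s \<le> 2 * G \<Longrightarrow> \<gamma> s \<le> C * \<alpha>w_lo s"
    using bigO_at_zero_bound[OF \<gamma>_bigO K_\<gamma> class_K(5)] by blast
  show thesis
  proof
    show "0 < 1 / (2 * C)" using C by simp
    fix y s t
    assume cont: "continuous_on {s..t} y" and "s \<le> t"
      and y: "\<And>\<tau>. s \<le> \<tau> \<Longrightarrow> \<tau> \<le> t \<Longrightarrow> norm (y \<tau>) \<le> \<rho>" and ev: "event \<gamma> U g y s t"
    obtain m where m: "s \<le> m" "m \<le> t"
      "sup_norm_on s t (sampling_error g y s) = norm (sampling_error g y s m)"
      using sup_error[OF cont \<open>s \<le> t\<close>] by metis
    define S where "S = norm (sampling_error g y s m)"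
    obtain p where p: "(SUP \<tau>\<in>{s..t}. U (sampling_error g y s \<tau>)) = U (sampling_error g y s p)"
      "\<And>\<tau>. s \<le> \<tau> \<Longrightarrow> \<tau> \<le> t \<Longrightarrow> U (sampling_error g y s \<tau>) \<le> U (sampling_error g y s p)"
      using max_U[OF cont \<open>s \<le> t\<close>] by metis
    have "S \<noteq> 0" and le: "U (sampling_error g y s p) \<le> 2 * (t - s) * \<gamma> S"
      using ev by (auto simp: event_def m(3) p(1) S_def)
    then have "S > 0" by (simp add: S_def)
    have "norm (g (y s)) \<le> G" "norm (g (y m)) \<le> G" using G y m \<open>s \<le> t\<close> by auto
    then have "S \<le> 2 * G"
      using norm_triangle_ineq4[of "g (y s)" "g (y m)"] by (simp add: S_def sampling_error_def)
    have "\<gamma> S \<le> C * \<alpha>w_lo S" by (rule C(2)) fact+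
    also have "\<dots> \<le> C * (2 * (t - s) * \<gamma> S)"
      using U_bounds(1)[of "sampling_error g y s m"] p(2)[of m] m le C(1)
      by (intro mult_left_mono) (auto simp: S_def)
    finally have "1 \<le> C * (2 * (t - s))"
      using class_K_inf_pos[OF K_\<gamma> \<open>S > 0\<close>] by (simp add: mult.assoc[symmetric])
    then show "s + 1 / (2 * C) \<le> t" using C(1) by (simp add: field_simps)
  qed
qed

text \<open>The inequality of the law survives the limit from the right, but the clause that the
  error is not identically zero need not. A nonzero error at \<open>e\<close> restores that
  clause.\<close>

lemma event_at_infimum:
  assumes cont: "continuous_on {s..b} y" and e: "s \<le> e" "e < b"
    and "sampling_error g y s e \<noteq> 0"
    and approx: "\<And>\<delta>. 0 < \<delta> \<Longrightarrow> \<exists>t. e \<le> t \<and> t < e + \<delta> \<and> t \<le> b \<and> event \<gamma> U g y s t"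
  shows "event \<gamma> U g y s e"
proof -
  define S where "S t = sup_norm_on s t (sampling_error g y s)" for t
  define M where "M t = (SUP \<tau>\<in>{s..t}. U (sampling_error g y s \<tau>))" for t
  have cont': "continuous_on {s..t} y" if "t \<le> b" for t
    by (rule continuous_on_subset[OF cont]) (use that in auto)
  have S_upper: "norm (sampling_error g y s \<tau>) \<le> S t" if "s \<le> \<tau>" "\<tau> \<le> t" "t \<le> b" for \<tau> t
    using sup_error_upper[OF cont' that(1)] that by (simp add: S_def)
  have "S e > 0" using S_upper[of e e] e assms(4) by (smt (verit) zero_less_norm_iff)
  have M_le: "M e \<le> 2 * (e + \<eta> - s) * \<gamma> (S e + \<eta>)" if "\<eta> > 0" for \<eta>
  proof -
    have "continuous (at e within {s..b}) (sampling_error g y s)"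
      using sampling_error_continuous[OF cont] e by (simp add: continuous_on_eq_continuous_within)
    then obtain \<delta> where \<delta>: "\<delta> > 0"
      "\<And>\<tau>. \<tau> \<in> {s..b} \<Longrightarrow> dist \<tau> e < \<delta> \<Longrightarrow> dist (sampling_error g y s \<tau>) (sampling_error g y s e) < \<eta>"
      unfolding continuous_within_eps_delta using \<open>\<eta> > 0\<close> by meson
    obtain t where t: "e \<le> t" "t < e + min \<delta> \<eta>" "t \<le> b" "event \<gamma> U g y s t"
      using approx[of "min \<delta> \<eta>"] \<delta>(1) \<open>\<eta> > 0\<close> by auto
    obtain m where m: "s \<le> m" "m \<le> t" "S t = norm (sampling_error g y s m)"
      unfolding S_def by (rule sup_error[OF cont'[OF t(3)] order_trans[OF e(1) t(1)]])
    \<comment> \<open>The supremum up to \<open>t\<close> is attained either before \<open>e\<close>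
      or so close to \<open>e\<close> that the error has changed by less than
      \<open>\<eta>\<close>.\<close>
    have "S t \<le> S e + \<eta>"
    proof (cases "m \<le> e")
      case True
      then show ?thesis using m S_upper[of m e] e \<open>\<eta> > 0\<close> by simp
    next
      case False
      then have "dist (sampling_error g y s m) (sampling_error g y s e) < \<eta>"
        using m t e by (intro \<delta>(2)) (auto simp: dist_real_def)
      then have "norm (sampling_error g y s m) \<le> norm (sampling_error g y s e) + \<eta>"
        unfolding dist_norm by norm
      then show ?thesis using S_upper[of e e] e m(3) by simp
    qed
    obtain p where p: "s \<le> p" "p \<le> e" "M e = U (sampling_error g y s p)"
      unfolding M_def by (rule max_U[OF cont'[OF less_imp_le[OF e(2)]] e(1)])
    have "s \<le> t" using e t by simp
    obtain q where q: "M t = U (sampling_error g y s q)"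
      "\<And>\<tau>. s \<le> \<tau> \<Longrightarrow> \<tau> \<le> t \<Longrightarrow> U (sampling_error g y s \<tau>) \<le> U (sampling_error g y s q)"
      unfolding M_def using max_U[OF cont'[OF t(3)] \<open>s \<le> t\<close>] by metis
    have "M e \<le> M t" using p q(2)[of p] q(1) t(1) by simp
    also have "\<dots> \<le> 2 * (t - s) * \<gamma> (S t)" using t(4) by (simp add: event_def S_def M_def)
    also have "\<dots> \<le> 2 * (e + \<eta> - s) * \<gamma> (S e + \<eta>)"
      using t e m \<open>S t \<le> S e + \<eta>\<close> \<open>\<eta> > 0\<close>
      by (intro mult_mono class_K_inf_mono[OF K_\<gamma>] class_K_inf_nonneg[OF K_\<gamma>]) auto
    finally show ?thesis .
  qed
  have "M e \<le> 2 * (e + 0 - s) * \<gamma> (S e + 0)"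
  proof (rule tendsto_lowerbound)
    \<comment> \<open>\<open>\<gamma>\<close> is continuous on the closed half-line only;
      \<open>S e > 0\<close> puts the point into its interior.\<close>
    have "isCont \<gamma> (S e + 0)"
      using K_\<gamma> \<open>S e > 0\<close> by (intro continuous_on_interior[of "{0..}"]) (auto simp: class_K_inf_def)
    then have "((\<lambda>\<eta>. \<gamma> (S e + \<eta>)) \<longlongrightarrow> \<gamma> (S e + 0)) (at_right 0)"
      by (rule isCont_tendsto_compose) (intro tendsto_intros)
    then show "((\<lambda>\<eta>. 2 * (e + \<eta> - s) * \<gamma> (S e + \<eta>)) \<longlongrightarrow> 2 * (e + 0 - s) * \<gamma> (S e + 0)) (at_right 0)"
      by (intro tendsto_intros)
    show "\<forall>\<^sub>F \<eta> in at_right 0. M e \<le> 2 * (e + \<eta> - s) * \<gamma> (S e + \<eta>)"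
      using eventually_at_right_less by (rule eventually_mono) (rule M_le)
  qed simp
  then show ?thesis using \<open>S e > 0\<close> by (simp add: event_def S_def M_def)
qed

subsection \<open>Executions\<close>

lemma event_cong:
  assumes "\<And>\<tau>. s \<le> \<tau> \<Longrightarrow> \<tau> \<le> t \<Longrightarrow> x \<tau> = y \<tau>" "s \<le> t"
  shows "event \<gamma> U g x s t \<longleftrightarrow> event \<gamma> U g y s t"
proof -
  have eq: "sampling_error g x s \<tau> = sampling_error g y s \<tau>" if "\<tau> \<in> {s..t}" for \<tau>
    using assms that by (simp add: sampling_error_def)
  then have "sup_norm_on s t (sampling_error g x s) = sup_norm_on s t (sampling_error g y s)"
    unfolding sup_norm_on_def by (intro SUP_cong) auto
  moreover have "(SUP \<tau>\<in>{s..t}. U (sampling_error g x s \<tau>)) = (SUP \<tau>\<in>{s..t}. U (sampling_error g y s \<tau>))"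
    using eq by (intro SUP_cong) auto
  ultimately show ?thesis by (simp add: event_def)
qed

text \<open>The recursion of the sampling instants as a map, with trajectory and horizon as
  arguments, so that instants of different trajectories and horizons can be compared.\<close>

definition next_event :: "(real \<Rightarrow> 'x) \<Rightarrow> ereal \<Rightarrow> ereal \<Rightarrow> ereal" where
  "next_event x T a = Inf {ereal t | t. a \<le> ereal t \<and> ereal t < T \<and> event \<gamma> U g x (real_of_ereal a) t}"

lemma next_event_ge: "a \<le> next_event x T a"
  unfolding next_event_def by (rule Inf_greatest) auto

lemma next_event_le: "s \<le> t \<Longrightarrow> ereal t < T \<Longrightarrow> event \<gamma> U g x s t \<Longrightarrow> next_event x T (ereal s) \<le> ereal t"
  unfolding next_event_def by (rule Inf_lower) auto

lemma next_event_approx: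
  assumes "next_event x T (ereal s) < r"
  obtains t where "s \<le> t" "ereal t < T" "ereal t < r" "event \<gamma> U g x s t"
    "next_event x T (ereal s) \<le> ereal t"
  using assms next_event_le unfolding next_event_def Inf_less_iff by auto

text \<open>The infimum lies below every event, and events lie strictly before the horizon. Hence no
  finite instant is at or after \<open>T\<close>.\<close>

lemma next_event_cases: "next_event x T a = \<infinity> \<or> next_event x T a < T"
proof (cases "{ereal t | t. a \<le> ereal t \<and> ereal t < T \<and> event \<gamma> U g x (real_of_ereal a) t} = {}")
  case True
  then have "next_event x T a = Inf {}" by (simp only: next_event_def)
  then show ?thesis by (simp add: top_ereal_def)
next
  case False
  then obtain t where "ereal t < T" "a \<le> ereal t" "event \<gamma> U g x (real_of_ereal a) t" by blast
  then have "next_event x T a \<le> ereal t" unfolding next_event_def by (intro Inf_lower) auto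
  then show ?thesis using \<open>ereal t < T\<close> by (blast intro: le_less_trans)
qed

lemma next_event_infinity: "next_event x T \<infinity> = \<infinity>"
  using next_event_ge[of \<infinity> x T] by simp

text \<open>Shortening the horizon discards only events at or after \<open>T\<close>, which cannot
  affect an infimum below \<open>T\<close>. For \<open>T = T'\<close> this is a congruence rule for
  trajectories that agree from \<open>s\<close> on.\<close>

lemma next_event_restrict:
  assumes "T \<le> T'" and eq: "\<And>\<tau>. s \<le> \<tau> \<Longrightarrow> ereal \<tau> < T \<Longrightarrow> x \<tau> = y \<tau>"
  shows "next_event x T (ereal s) = (if next_event y T' (ereal s) < T then next_event y T' (ereal s) else \<infinity>)"
proof -
  have ev: "event \<gamma> U g x s t \<longleftrightarrow> event \<gamma> U g y s t" if "s \<le> t" "ereal t < T" for t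
  proof (rule event_cong)
    show "x \<tau> = y \<tau>" if "s \<le> \<tau>" "\<tau> \<le> t" for \<tau>
      using that(1) ereal_le_less_trans[OF that(2) \<open>ereal t < T\<close>] by (rule eq)
  qed fact
  have le: "next_event y T' (ereal s) \<le> next_event x T (ereal s)"
    unfolding next_event_def[of x]
  proof (rule Inf_greatest)
    fix r assume "r \<in> {ereal t | t. ereal s \<le> ereal t \<and> ereal t < T \<and> event \<gamma> U g x (real_of_ereal (ereal s)) t}"
    then obtain t where t: "r = ereal t" "s \<le> t" "ereal t < T" "event \<gamma> U g x s t" by auto
    then show "next_event y T' (ereal s) \<le> r"
      using ev less_le_trans[OF t(3) assms(1)] by (auto intro: next_event_le)
  qed
  show ?thesis
  proof (cases "next_event y T' (ereal s) < T")
    case True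
    have "next_event x T (ereal s) \<le> next_event y T' (ereal s)"
    proof (rule ccontr)
      assume "\<not> ?thesis"
      then have "next_event y T' (ereal s) < min T (next_event x T (ereal s))" using True by simp
      then obtain t where "s \<le> t" "ereal t < T" "ereal t < next_event x T (ereal s)" "event \<gamma> U g y s t"
        by (rule next_event_approx) simp
      then show False using next_event_le[of s t T x] ev by simp
    qed
    then show ?thesis using le True by simp
  next
    case False
    then show ?thesis using le next_event_cases[of x T "ereal s"] by auto
  qed
qed

text \<open>The form of \<open>execution\<close> used in all proofs: the start of an interval is a
  real \<open>s\<close>, so the value that \<open>real_of_ereal\<close> assigns to
  \<open>\<infinity>\<close> never matters.\<close>

definition run :: "real \<Rightarrow> ereal \<Rightarrow> (real \<Rightarrow> 'd) \<Rightarrow> (real \<Rightarrow> 'x) \<Rightarrow> (nat \<Rightarrow> ereal) \<Rightarrow> bool" where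
  "run t0 T d x tk \<longleftrightarrow> ereal t0 < T \<and> tk 0 = ereal t0 \<and> (\<forall>k. tk (Suc k) = next_event x T (tk k)) \<and>
     (\<forall>k s t. tk k = ereal s \<and> s \<le> t \<and> ereal t \<le> tk (Suc k) \<and> ereal t < T \<longrightarrow> hold d (g (x s)) s t x) \<and>
     T \<le> (SUP k. tk k)"

lemma sampling_instant_ge:
  assumes "tk 0 = ereal t0" "\<And>k. tk (Suc k) = next_event x T (tk k)"
  shows "ereal t0 \<le> tk k"
  by (induction k) (use assms next_event_ge order_trans in \<open>auto, blast\<close>)

text \<open>All instants are at least \<open>t0\<close>, hence an instant that lies below a real
  time is itself real.\<close>

lemma execution_iff_run:
  assumes "g = \<kappa> \<circ> h"
  shows "execution f \<kappa> h \<gamma> U t0 T d x tk \<longleftrightarrow> run t0 T d x tk"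
proof -
  have eq: "\<kappa> (h z) = g z" for z by (simp add: assms)
  have "(\<forall>k t. tk k \<le> ereal t \<and> ereal t \<le> tk (Suc k) \<and> ereal t < T \<longrightarrow>
        ((\<lambda>s. f (x s) (g (x (real_of_ereal (tk k)))) (d s))
           has_integral (x t - x (real_of_ereal (tk k)))) {real_of_ereal (tk k)..t}) \<longleftrightarrow>
     (\<forall>k s t. tk k = ereal s \<and> s \<le> t \<and> ereal t \<le> tk (Suc k) \<and> ereal t < T \<longrightarrow> hold d (g (x s)) s t x)"
    (is "?L \<longleftrightarrow> ?R")
    if tk: "tk 0 = ereal t0" "\<And>k. tk (Suc k) = next_event x T (tk k)"
  proof
    assume L: ?L
    show ?R
    proof (intro allI impI)
      fix k s t assume *: "tk k = ereal s \<and> s \<le> t \<and> ereal t \<le> tk (Suc k) \<and> ereal t < T"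
      show "hold d (g (x s)) s t x"
        unfolding hold_def
      proof
        fix t' assume "t' \<in> {s..t}"
        then have "tk k \<le> ereal t' \<and> ereal t' \<le> tk (Suc k) \<and> ereal t' < T"
          using * by (auto intro: order_trans[of "ereal t'" "ereal t"] le_less_trans[of "ereal t'" "ereal t"])
        then show "((\<lambda>\<sigma>. f (x \<sigma>) (g (x s)) (d \<sigma>)) has_integral x t' - x s) {s..t'}"
          using L[rule_format, of k t'] * by simp
      qed
    qed
  next
    assume R: ?R
    show ?L
    proof (intro allI impI)
      fix k t assume *: "tk k \<le> ereal t \<and> ereal t \<le> tk (Suc k) \<and> ereal t < T"
      obtain s where s: "tk k = ereal s"
        using * sampling_instant_ge[OF tk, of k] by (cases "tk k") auto
      then have "hold d (g (x s)) s t x" using R * by auto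
      then show "((\<lambda>s. f (x s) (g (x (real_of_ereal (tk k)))) (d s))
           has_integral (x t - x (real_of_ereal (tk k)))) {real_of_ereal (tk k)..t}"
        using s * by (simp add: hold_def)
    qed
  qed
  then show ?thesis
    unfolding execution_def run_def eq assms[symmetric] next_event_def[symmetric] by blast
qed

section \<open>Estimates along a run\<close>

context
  fixes t0 T d x tk
  assumes run: "run t0 T d x tk"
begin

lemma run_Suc: "tk (Suc k) = next_event x T (tk k)"
  using run by (simp add: run_def)

lemma run_0: "tk 0 = ereal t0"
  using run by (simp add: run_def)

lemma run_hold: "tk k = ereal s \<Longrightarrow> s \<le> t \<Longrightarrow> ereal t \<le> tk (Suc k) \<Longrightarrow> ereal t < T \<Longrightarrow> hold d (g (x s)) s t x"
  using run unfolding run_def by blast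

lemma run_ge: "ereal t0 \<le> tk k"
  using run by (intro sampling_instant_ge) (auto simp: run_def)

lemma run_ge': "tk k = ereal s \<Longrightarrow> t0 \<le> s"
  using run_ge[of k] by simp

lemma run_mono: "tk k \<le> tk (Suc k)"
  by (simp add: run_Suc next_event_ge)

lemma run_cases: "tk k = \<infinity> \<or> tk k < T"
proof (cases k)
  case 0
  then show ?thesis using run by (simp add: run_def)
next
  case (Suc j)
  then show ?thesis using next_event_cases by (simp add: run_Suc)
qed

lemma run_finite_prev:
  assumes "tk (Suc k) = ereal s'"
  obtains s where "tk k = ereal s" "t0 \<le> s" "s \<le> s'" "ereal s' < T"
  using that run_ge[of k] run_mono[of k] run_cases[of "Suc k"] assms by (cases "tk k") auto

lemma run_cover:
  assumes "t0 \<le> t" "ereal t < T"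
  obtains k s where "tk k = ereal s" "t0 \<le> s" "s \<le> t" "ereal t < tk (Suc k)"
proof -
  have "ereal t < (SUP k. tk k)" using assms(2) run by (auto simp: run_def)
  then have ex: "\<exists>k. ereal t < tk k" by (simp add: less_SUP_iff)
  define j where "j = (LEAST k. ereal t < tk k)"
  have j: "ereal t < tk j" unfolding j_def by (rule LeastI_ex[OF ex])
  then obtain k where k: "j = Suc k" using assms(1) run_0 by (cases j) auto
  then have "\<not> ereal t < tk k" using not_less_Least[of k "\<lambda>k. ereal t < tk k"] by (simp add: j_def)
  then obtain s where "tk k = ereal s" "t0 \<le> s" "s \<le> t" using run_ge[of k] by (cases "tk k") auto
  then show thesis using that j k by auto
qed

lemma run_nonevent:
  "tk k = ereal s \<Longrightarrow> s \<le> t \<Longrightarrow> ereal t < tk (Suc k) \<Longrightarrow> ereal t < T \<Longrightarrow> \<not> event \<gamma> U g x s t"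
  using next_event_le[of s t T x] by (auto simp: run_Suc)

context
  assumes d: "\<And>t. t0 \<le> t \<Longrightarrow> d t \<in> D"
begin

text \<open>Bridge from estimates that assume no event to the closed sampling interval: they apply
  at every earlier time, and continuity of \<open>V\<close> and \<open>\<psi>\<close> reaches the
  right end.\<close>

lemma run_piece:
  assumes k: "tk k = ereal s" "s \<le> t" "ereal t \<le> tk (Suc k)" "ereal t < T"
    and \<psi>: "continuous_on {s..t} \<psi>" "V (x s) \<le> \<psi> s"
    and le: "\<And>\<tau>. hold d (g (x s)) s \<tau> x \<Longrightarrow> s \<le> \<tau> \<Longrightarrow> (\<And>\<tau>'. s \<le> \<tau>' \<Longrightarrow> \<tau>' \<le> \<tau> \<Longrightarrow> d \<tau>' \<in> D) \<Longrightarrow>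
      \<not> event \<gamma> U g x s \<tau> \<Longrightarrow> V (x \<tau>) \<le> \<psi> \<tau>"
  shows "V (x t) \<le> \<psi> t"
proof (rule closed_interval_le[of s t "\<lambda>\<tau>. V (x \<tau>)"])
  have hold: "hold d (g (x s)) s t x" using k by (rule run_hold)
  then show "continuous_on {s..t} (\<lambda>\<tau>. V (x \<tau>))" by (intro V_along hold_continuous_on)
  fix \<tau> assume \<tau>: "s \<le> \<tau>" "\<tau> < t"
  show "V (x \<tau>) \<le> \<psi> \<tau>"
  proof (rule le)
    show "hold d (g (x s)) s \<tau> x" using hold by (rule hold_subinterval) (use \<tau> in auto)
    show "\<not> event \<gamma> U g x s \<tau>"
      using k \<tau> ereal_less_le_trans[OF \<tau>(2)] ereal_le_less_trans[of \<tau> t T]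
      by (intro run_nonevent[of k]) auto
  qed (use \<tau> d run_ge'[OF k(1)] in auto)
qed (use k \<psi> in auto)

lemma run_piece_V_le:
  assumes "tk k = ereal s" "s \<le> t" "ereal t \<le> tk (Suc k)" "ereal t < T"
  shows "V (x t) \<le> V (x s)"
  by (rule run_piece[OF assms, of "\<lambda>_. V (x s)"]) (auto intro: nonevent_V_le)

text \<open>Induction over the sampling intervals with a property of real times. The same step
  passes to the next instant and to times inside an interval, and \<open>run_cover\<close> ensures
  that every time before \<open>T\<close> is reached.\<close>

lemma run_induct:
  assumes base: "P t0"
    and step: "\<And>k s t. tk k = ereal s \<Longrightarrow> t0 \<le> s \<Longrightarrow> s \<le> t \<Longrightarrow> ereal t \<le> tk (Suc k) \<Longrightarrow> ereal t < T \<Longrightarrow> P s \<Longrightarrow> P t"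
    and t: "t0 \<le> t" "ereal t < T"
  shows "P t"
proof -
  have sampled: "\<forall>s. tk k = ereal s \<longrightarrow> P s" for k
  proof (induction k)
    case 0
    then show ?case using base run_0 by auto
  next
    case (Suc k)
    show ?case
    proof (intro allI impI)
      fix s' assume s': "tk (Suc k) = ereal s'"
      from run_finite_prev[OF this] obtain s where "tk k = ereal s" "t0 \<le> s" "s \<le> s'" "ereal s' < T" .
      then show "P s'" using step[of k s s'] Suc s' by auto
    qed
  qed
  from run_cover[OF t] obtain k s where "tk k = ereal s" "t0 \<le> s" "s \<le> t" "ereal t < tk (Suc k)" .
  then show ?thesis using step[of k s t] sampled t by auto
qed

lemma run_V_le: "t0 \<le> t \<Longrightarrow> ereal t < T \<Longrightarrow> V (x t) \<le> V (x t0)"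
  by (rule run_induct[of "\<lambda>t. V (x t) \<le> V (x t0)"]) (auto dest: run_piece_V_le)

text \<open>The rate is the same on all pieces and a bound of the form \<open>max v _\<close> is
  stable under composition, so the number of events does not enter.\<close>

lemma run_decay:
  assumes w0: "0 < w0" and c: "0 < c" "\<And>x. v \<le> V x \<Longrightarrow> c \<le> \<alpha> (norm x) - \<sigma> w0"
    and t: "t0 \<le> t" "ereal t < T"
  shows "V (x t) \<le> max v (V (x t0) - min c (2 * \<gamma> w0) * (t - t0))"
proof (rule run_induct[OF _ _ t])
  define c' where "c' = min c (2 * \<gamma> w0)"
  have "0 \<le> c'" using c(1) class_K_inf_pos[OF K_\<gamma> w0] by (simp add: c'_def)
  fix k s t assume k: "tk k = ereal s" "t0 \<le> s" "s \<le> t" "ereal t \<le> tk (Suc k)" "ereal t < T"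
    and IH: "V (x s) \<le> max v (V (x t0) - min c (2 * \<gamma> w0) * (s - t0))"
  have "V (x t) \<le> max v (V (x s) - c' * (t - s))"
  proof (rule run_piece[OF k(1,3-), of "\<lambda>t. max v (V (x s) - c' * (t - s))"])
    show "continuous_on {s..t} (\<lambda>t. max v (V (x s) - c' * (t - s)))"
      by (intro continuous_intros)
  qed (use w0 c in \<open>auto simp only: c'_def intro: nonevent_decay, simp\<close>)
  also have "\<dots> \<le> max v (V (x t0) - c' * (t - t0))"
  proof -
    have "0 \<le> c' * (t - s)" using \<open>0 \<le> c'\<close> k by simp
    moreover have "c' * (t - t0) = c' * (t - s) + c' * (s - t0)" by (simp add: algebra_simps)
    ultimately show ?thesis using IH by (simp add: c'_def[symmetric] max_def split: if_splits)
  qed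
  finally show "V (x t) \<le> max v (V (x t0) - min c (2 * \<gamma> w0) * (t - t0))" by (simp only: c'_def)
qed simp

lemma run_continuous:
  assumes "t0 \<le> t" "ereal t < T"
  shows "continuous_on {t0..t} x"
proof (rule run_induct[of "\<lambda>t. continuous_on {t0..t} x", OF _ _ assms])
  fix k s t assume k: "tk k = ereal s" "t0 \<le> s" "s \<le> t" "ereal t \<le> tk (Suc k)" "ereal t < T"
    and IH: "continuous_on {t0..s} x"
  have "continuous_on {s..t} x" using run_hold k by (blast intro: hold_continuous_on)
  with IH have "continuous_on ({t0..s} \<union> {s..t}) x" by (intro continuous_on_closed_Un) auto
  then show "continuous_on {t0..t} x" using k by (simp add: ivl_disj_un_two_touch)
qed simp

lemma run_dwell:
  assumes \<rho>: "\<And>z. V z \<le> V (x t0) \<Longrightarrow> norm z \<le> \<rho>"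
    and \<delta>: "\<And>y s t. continuous_on {s..t} y \<Longrightarrow> s \<le> t \<Longrightarrow> (\<And>\<tau>. s \<le> \<tau> \<Longrightarrow> \<tau> \<le> t \<Longrightarrow> norm (y \<tau>) \<le> \<rho>) \<Longrightarrow>
       event \<gamma> U g y s t \<Longrightarrow> s + \<delta> \<le> t"
    and k: "tk k = ereal s"
  shows "ereal (s + \<delta>) \<le> tk (Suc k)"
proof (rule ccontr)
  assume "\<not> ?thesis"
  then have "next_event x T (ereal s) < ereal (s + \<delta>)" by (simp add: run_Suc k)
  then obtain t where t: "s \<le> t" "ereal t < T" "ereal t < ereal (s + \<delta>)" "event \<gamma> U g x s t"
    by (rule next_event_approx)
  have "continuous_on {s..t} x"
    by (rule continuous_on_subset[OF run_continuous]) (use t run_ge'[OF k] in auto)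
  moreover have "norm (x \<tau>) \<le> \<rho>" if "s \<le> \<tau>" "\<tau> \<le> t" for \<tau>
    using that t(2) run_ge'[OF k] ereal_le_less_trans[of \<tau> t T] by (intro \<rho> run_V_le) auto
  ultimately have "s + \<delta> \<le> t" using t by (intro \<delta>) auto
  then show False using t(3) by simp
qed

text \<open>The run stays in the sublevel set of its initial state, which lies in a ball. One dwell
  time \<open>\<delta>\<close> thus serves all intervals, and the instants grow at least
  linearly.\<close>

lemma run_finitely_many: "finite {k. tk k \<le> ereal r}"
proof -
  obtain \<rho> where \<rho>: "\<And>s. \<alpha>_lo s \<le> V (x t0) \<Longrightarrow> s \<le> \<rho>"
    using class_K_inf_bounded_preimage[OF class_K(1)] by metis
  obtain \<delta> where \<delta>: "0 < \<delta>"
    "\<And>y s t. continuous_on {s..t} y \<Longrightarrow> s \<le> t \<Longrightarrow> (\<And>\<tau>. s \<le> \<tau> \<Longrightarrow> \<tau> \<le> t \<Longrightarrow> norm (y \<tau>) \<le> \<rho>) \<Longrightarrow>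
       event \<gamma> U g y s t \<Longrightarrow> s + \<delta> \<le> t"
    using dwell_time[of \<rho>] by metis
  have bound: "norm z \<le> \<rho>" if "V z \<le> V (x t0)" for z
    using that V_bounds(1)[of z] by (intro \<rho>) simp
  have ge: "ereal (t0 + real k * \<delta>) \<le> tk k" for k
  proof (induction k)
    case 0
    then show ?case using run_0 by simp
  next
    case (Suc k)
    show ?case
    proof (cases "tk k")
      case (real s)
      then have "t0 + real (Suc k) * \<delta> \<le> s + \<delta>" using Suc by (simp add: algebra_simps)
      moreover have "ereal (s + \<delta>) \<le> tk (Suc k)" using bound \<delta>(2) real by (rule run_dwell)
      ultimately show ?thesis by (meson ereal_less_eq(3) order_trans)
    next
      case PInf
      then show ?thesis using run_mono[of k] by simp
    next
      case MInf
      then show ?thesis using run_ge[of k] by simp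
    qed
  qed
  have "{k. tk k \<le> ereal r} \<subseteq> {..nat \<lfloor>(r - t0) / \<delta>\<rfloor>}"
  proof
    fix k assume "k \<in> {k. tk k \<le> ereal r}"
    then have "ereal (t0 + real k * \<delta>) \<le> ereal r" using ge[of k] order_trans by blast
    then have "real k \<le> (r - t0) / \<delta>" using \<delta>(1) by (simp add: field_simps)
    then show "k \<in> {..nat \<lfloor>(r - t0) / \<delta>\<rfloor>}" by (simp add: le_nat_iff le_floor_iff)
  qed
  then show ?thesis by (rule finite_subset) simp
qed

text \<open>Only finitely many instants are at most \<open>T'\<close>. The one after the last of
  them is infinite, because finite instants lie before the horizon.\<close>

lemma run_last_sample:
  assumes "T = ereal T'"
  obtains k s where "tk k = ereal s" "t0 \<le> s" "s < T'" "tk (Suc k) = \<infinity>"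
proof -
  define k where "k = Max {k. tk k \<le> ereal T'}"
  have "0 \<in> {k. tk k \<le> ereal T'}" using run_0 run assms by (auto simp: run_def)
  then have k: "tk k \<le> ereal T'"
    unfolding k_def using Max_in[OF run_finitely_many[of T']] by blast
  then obtain s where s: "tk k = ereal s" "t0 \<le> s" using run_ge[of k] by (cases "tk k") auto
  have "\<not> tk (Suc k) \<le> ereal T'"
    using Max_ge[OF run_finitely_many[of T'], of "Suc k"] by (auto simp: k_def)
  then have "tk (Suc k) = \<infinity>" using run_cases[of "Suc k"] assms by auto
  then show thesis using that s run_cases[of k] assms by auto
qed

end

end

subsection \<open>Continuation and global existence\<close>

text \<open>Instants up to index \<open>k\<close> are real, so the events that determine them lie
  before \<open>T\<close> and the longer horizon does not change them. Only the conditions from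
  index \<open>k\<close> on have to be verified.\<close>

lemma run_extend:
  assumes run: "run t0 T d x tk" and "T \<le> T'"
    and eq: "\<And>\<tau>. t0 \<le> \<tau> \<Longrightarrow> ereal \<tau> < T \<Longrightarrow> x' \<tau> = x \<tau>"
    and k: "tk k = ereal s" and tk': "\<And>j. j \<le> k \<Longrightarrow> tk' j = tk j"
    and next': "\<And>j. k \<le> j \<Longrightarrow> tk' (Suc j) = next_event x' T' (tk' j)"
    and hold': "\<And>j s t. k \<le> j \<Longrightarrow> tk' j = ereal s \<Longrightarrow> s \<le> t \<Longrightarrow> ereal t \<le> tk' (Suc j) \<Longrightarrow>
      ereal t < T' \<Longrightarrow> hold d (g (x' s)) s t x'"
    and cover: "tk' i = \<infinity>"
  shows "run t0 T' d x' tk'"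
proof -
  have old: "tk' (Suc j) = next_event x' T' (tk' j) \<and>
      (\<forall>r t. tk' j = ereal r \<and> r \<le> t \<and> ereal t \<le> tk' (Suc j) \<longrightarrow> hold d (g (x' r)) r t x')" if "j < k" for j
  proof -
    have "tk (Suc j) \<le> tk k" using that by (intro lift_Suc_mono_le[of tk, OF run_mono[OF run]]) auto
    then obtain e where e: "tk (Suc j) = ereal e"
      using k run_ge[OF run, of "Suc j"] by (cases "tk (Suc j)") auto
    obtain r where r: "tk j = ereal r" "t0 \<le> r" "r \<le> e" "ereal e < T"
      using run_finite_prev[OF run e] .
    have "next_event x T (ereal r) = (if next_event x' T' (ereal r) < T then next_event x' T' (ereal r) else \<infinity>)"
      using r(2) by (intro next_event_restrict[OF \<open>T \<le> T'\<close>]) (simp add: eq)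
    then have "tk (Suc j) = next_event x' T' (tk j)"
      using e run_Suc[OF run, of j] r(1) by (auto split: if_splits)
    moreover have "hold d (g (x' r)) r t x'" if "r \<le> t" "ereal t \<le> tk (Suc j)" for t
    proof -
      have "ereal t < T" using that e r ereal_le_less_trans[of t e T] by simp
      then have same: "x' \<tau> = x \<tau>" if "r \<le> \<tau>" "\<tau> \<le> t" for \<tau>
        using that r(2) ereal_le_less_trans[of \<tau> t T] by (intro eq) auto
      have "hold d (g (x r)) r t x" using run_hold[OF run r(1)] that \<open>ereal t < T\<close> by simp
      then have "hold d (g (x r)) r t x'" using hold_cong[of r t x' x] same by simp
      then show ?thesis using same[of r] that by simp
    qed
    ultimately show ?thesis using tk' that r(1) by simp
  qed
  show ?thesis
    unfolding run_def
  proof (intro conjI allI impI)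
    show "ereal t0 < T'" using run \<open>T \<le> T'\<close> by (auto simp: run_def)
    show "tk' 0 = ereal t0" using run tk' by (simp add: run_def)
    show "tk' (Suc j) = next_event x' T' (tk' j)" for j
      using old next' by (cases "j < k") auto
    show "hold d (g (x' r)) r t x'"
      if "tk' j = ereal r \<and> r \<le> t \<and> ereal t \<le> tk' (Suc j) \<and> ereal t < T'" for j r t
      using old[of j] hold'[of j r t] that by (cases "j < k") auto
    show "T' \<le> (SUP j. tk' j)" using SUP_upper[of i UNIV tk'] cover by simp
  qed
qed

section \<open>Continuation by a uniform time step\<close>

lemma norm_bound:
  obtains \<rho> where "\<And>z. V z \<le> R \<Longrightarrow> norm z \<le> \<rho>"
proof -
  obtain \<rho> where "\<And>s. \<alpha>_lo s \<le> R \<Longrightarrow> s \<le> \<rho>"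
    using class_K_inf_bounded_preimage[OF class_K(1)] by metis
  then show thesis using that[of \<rho>] V_bounds(1) order_trans by blast
qed

lemma disturbances_measurable:
  assumes "d \<in> disturbances D t0" "t0 \<le> s"
  shows "d \<in> borel_measurable (lebesgue_on {s..t})"
proof (rule measurable_restrict_mono)
  show "d \<in> borel_measurable (lebesgue_on {t0..})"
    using assms(1) unfolding disturbances_def by blast
  show "{s..t} \<subseteq> {t0..}" using assms(2) by auto
qed

text \<open>\<open>\<delta>\<close> depends on the level \<open>R\<close> only, not on
  \<open>T\<close> or on the run. As \<open>V\<close> stays below \<open>R\<close> along the run,
  the step can be iterated.\<close>

lemma extension:
  obtains \<delta> where "0 < \<delta>"
    "\<And>d \<xi>. d \<in> disturbances D t0 \<Longrightarrow> V \<xi> \<le> R \<Longrightarrow> \<exists>x tk. x t0 = \<xi> \<and> run t0 (ereal (t0 + \<delta>)) d x tk"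
    "\<And>d x tk T. d \<in> disturbances D t0 \<Longrightarrow> run t0 (ereal T) d x tk \<Longrightarrow> V (x t0) \<le> R \<Longrightarrow>
       \<exists>x' tk'. run t0 (ereal (T + \<delta>)) d x' tk' \<and> (\<forall>t. t0 \<le> t \<and> t < T \<longrightarrow> x' t = x t)"
proof -
  obtain \<rho> where \<rho>: "\<And>z. V z \<le> R \<Longrightarrow> norm z \<le> \<rho>" using norm_bound by blast
  obtain G where G: "\<And>z. norm z \<le> \<rho> \<Longrightarrow> norm (g z) \<le> G" using g_bounded by blast
  show thesis
  proof (rule local_hold[of G \<rho>], goal_cases)
    case \<delta>1: (1 \<delta>1)
    \<comment> \<open>The radius is \<open>\<rho> + 1\<close> because local solutions starting in
      the ball of radius \<open>\<rho>\<close> may leave it by 1.\<close>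
    obtain \<delta>2 where \<delta>2: "0 < \<delta>2"
      "\<And>y s t. continuous_on {s..t} y \<Longrightarrow> s \<le> t \<Longrightarrow> (\<And>\<tau>. s \<le> \<tau> \<Longrightarrow> \<tau> \<le> t \<Longrightarrow> norm (y \<tau>) \<le> \<rho> + 1) \<Longrightarrow>
         event \<gamma> U g y s t \<Longrightarrow> s + \<delta>2 \<le> t"
      using dwell_time[of "\<rho> + 1"] by metis
    \<comment> \<open>\<open>2 * \<delta> \<le> \<delta>1\<close> lets a solution restarted at
      \<open>T - \<delta>\<close> reach \<open>T + \<delta>\<close>.
      \<open>\<delta> \<le> \<delta>2\<close> excludes a second event between a new instant
      \<open>e \<ge> T\<close> and \<open>T + \<delta>\<close>.\<close>
    define \<delta> where "\<delta> = min \<delta>1 \<delta>2 / 2"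
    have \<delta>: "0 < \<delta>" "2 * \<delta> \<le> \<delta>1" "\<delta> \<le> \<delta>2" using \<delta>1(1) \<delta>2(1) by (auto simp: \<delta>_def)
    have start: "\<exists>y. y s = \<xi> \<and> hold d (g \<xi>) s (s + \<delta>1) y \<and> (\<forall>t. norm (y t) \<le> \<rho> + 1)"
      if "d \<in> disturbances D t0" "t0 \<le> s" "norm \<xi> \<le> \<rho>" for d s \<xi>
      using that by (intro \<delta>1(2) G disturbances_measurable) (auto simp: disturbances_def)
    have no_event: "next_event y (ereal b) (ereal s) = \<infinity>"
      if "hold d u s b y" "\<And>t. s \<le> t \<Longrightarrow> t \<le> b \<Longrightarrow> norm (y t) \<le> \<rho> + 1" "b \<le> s + \<delta>" for d u s b y
    proof (rule ccontr)
      assume "next_event y (ereal b) (ereal s) \<noteq> \<infinity>"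
      then have "next_event y (ereal b) (ereal s) < ereal b" using next_event_cases by blast
      then obtain t where t: "s \<le> t" "t < b" "event \<gamma> U g y s t" by (rule next_event_approx) simp
      have "continuous_on {s..t} y"
        by (rule continuous_on_subset[OF hold_continuous_on[OF that(1)]]) (use t in auto)
      then have "s + \<delta>2 \<le> t" using t that(2) by (intro \<delta>2(2)) auto
      then show False using that(3) t \<delta>(3) by simp
    qed
    show thesis
    proof
      show "0 < \<delta>" by fact
    next
      fix d \<xi> assume d: "d \<in> disturbances D t0" and "V \<xi> \<le> R"
      then obtain y where y: "y t0 = \<xi>" "hold d (g \<xi>) t0 (t0 + \<delta>1) y" "\<And>t. norm (y t) \<le> \<rho> + 1"
        using start[of d t0 \<xi>] \<rho> by auto
      define tk where "tk k = (if k = 0 then ereal t0 else \<infinity>)" for k :: nat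
      have hold: "hold d (g (y t0)) t0 t y" if "t \<le> t0 + \<delta>" for t
        using y that \<delta> by (auto intro: hold_subinterval)
      have "run t0 (ereal (t0 + \<delta>)) d y tk"
        unfolding run_def
      proof (intro conjI allI impI)
        show "tk (Suc j) = next_event y (ereal (t0 + \<delta>)) (tk j)" for j
          using no_event[OF hold, of "t0 + \<delta>"] y(3) by (simp add: tk_def next_event_infinity)
        show "ereal (t0 + \<delta>) \<le> (SUP k. tk k)" using SUP_upper[of 1 UNIV tk] by (simp add: tk_def)
      qed (use \<delta> hold in \<open>auto simp: tk_def split: if_splits\<close>)
      then show "\<exists>x tk. x t0 = \<xi> \<and> run t0 (ereal (t0 + \<delta>)) d x tk" using y(1) by blast
    next
      fix d x tk T
      assume d: "d \<in> disturbances D t0" and run: "run t0 (ereal T) d x tk" and R: "V (x t0) \<le> R"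
      have dD: "d t \<in> D" if "t0 \<le> t" for t using d that by (simp add: disturbances_def)
      obtain k s where k: "tk k = ereal s" "t0 \<le> s" "s < T" "tk (Suc k) = \<infinity>"
        using run_last_sample[OF run dD refl] by blast
      have x_hold: "hold d (g (x s)) s t x" if "s \<le> t" "t < T" for t
        using run_hold[OF run k(1)] that k by simp
      have x_V: "V (x t) \<le> R" if "t0 \<le> t" "t < T" for t
        using run_V_le[OF run dD, of t] that R by simp
      have x_norm: "norm (x t) \<le> \<rho>" if "t0 \<le> t" "t < T" for t
        using that by (intro \<rho> x_V)
      have u: "norm (g (x s)) \<le> G" using k by (intro G x_norm) auto
      \<comment> \<open>Restarting before \<open>T\<close> and using uniqueness on the overlap avoids the limit of \<open>x\<close> at \<open>T\<close>.\<close>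
      define r where "r = max s (T - \<delta>)"
      have r: "s \<le> r" "t0 \<le> r" "r < T" "T + \<delta> \<le> r + \<delta>1" using k \<delta> by (auto simp: r_def)
      obtain y1 where y1: "y1 r = x r" "hold d (g (x s)) r (r + \<delta>1) y1" "\<And>t. norm (y1 t) \<le> \<rho> + 1"
        using \<delta>1(2)[of d r "g (x s)" "x r"] disturbances_measurable[OF d, of r "r + \<delta>1"] dD r u x_norm
        by auto
      define y where "y t = (if t \<le> r then x t else y1 t)" for t
      have y_x: "y t = x t" if "s \<le> t" "t < T" for t
      proof (cases "t \<le> r")
        case False
        have "y1 t = x t"
        proof (rule \<delta>1(3)[of d "g (x s)" r t])
          show "hold d (g (x s)) r t y1" using y1(2) by (rule hold_subinterval) (use that r \<delta> in auto)
          show "hold d (g (x s)) r t x" by (rule hold_subinterval[OF x_hold[of t]]) (use that r in auto)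
          show "d \<sigma> \<in> D \<and> norm (y1 \<sigma>) \<le> \<rho> + 1 \<and> norm (x \<sigma>) \<le> \<rho> + 1" if "r \<le> \<sigma>" "\<sigma> \<le> t" for \<sigma>
            using that r dD[of \<sigma>] y1(3)[of \<sigma>] x_norm[of \<sigma>] \<open>t < T\<close> by simp
        qed (use False that r \<delta> y1(1) u in auto)
        then show ?thesis using False by (simp add: y_def)
      qed (simp add: y_def)
      have y_hold: "hold d (g (y s)) s (T + \<delta>) y"
      proof -
        have "hold d (g (x s)) s r y"
          using hold_cong[of s r y x] x_hold[of r] r by (simp add: y_def)
        moreover have "hold d (g (x s)) r (T + \<delta>) y"
        proof -
          have "hold d (g (x s)) r (T + \<delta>) y1" using y1(2) by (rule hold_subinterval) (use r in auto)
          then show ?thesis using hold_cong[of r "T + \<delta>" y y1] y1(1) by (simp add: y_def)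
        qed
        ultimately have "hold d (g (x s)) s (T + \<delta>) y" by (rule hold_join)
        then show ?thesis using y_x[of s] k by simp
      qed
      have y_norm: "norm (y t) \<le> \<rho> + 1" if "s \<le> t" for t
        using x_norm[of t] y1(3)[of t] that k r by (auto simp: y_def)
      \<comment> \<open>With the old horizon there was no event after \<open>s\<close>, so by
        truncation the longer curve has none before \<open>T\<close>.\<close>
      have no_event_before: "ereal T \<le> next_event y (ereal (T + \<delta>)) (ereal s)"
      proof -
        have "next_event x (ereal T) (ereal s) = \<infinity>" using k(1,4) run_Suc[OF run, of k] by simp
        moreover have "next_event x (ereal T) (ereal s) =
            (if next_event y (ereal (T + \<delta>)) (ereal s) < ereal T then next_event y (ereal (T + \<delta>)) (ereal s) else \<infinity>)"
          using \<delta> y_x by (intro next_event_restrict) auto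
        ultimately show ?thesis by (auto split: if_splits)
      qed
      have tk_inf: "tk j = \<infinity>" if "k < j" for j
        using lift_Suc_mono_le[of tk, OF run_mono[OF run], of "Suc k" j] that k(4) by simp
      show "\<exists>x' tk'. run t0 (ereal (T + \<delta>)) d x' tk' \<and> (\<forall>t. t0 \<le> t \<and> t < T \<longrightarrow> x' t = x t)"
      proof (cases "next_event y (ereal (T + \<delta>)) (ereal s) = \<infinity>")
        case True
        define x' where "x' t = (if t < T then x t else y t)" for t
        have x'_y: "x' t = y t" if "s \<le> t" for t using that y_x[of t] by (simp add: x'_def)
        have next_x': "next_event x' (ereal (T + \<delta>)) (ereal s) = \<infinity>"
          using next_event_restrict[of "ereal (T + \<delta>)" "ereal (T + \<delta>)" s x' y] x'_y True by simp
        have "run t0 (ereal (T + \<delta>)) d x' tk"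
        proof (rule run_extend[OF run])
          show "tk (Suc j) = next_event x' (ereal (T + \<delta>)) (tk j)" if "k \<le> j" for j
            using that next_x' k tk_inf[of j] tk_inf[of "Suc j"]
            by (cases "k = j") (auto simp: next_event_infinity)
          show "hold d (g (x' s')) s' t x'"
            if "k \<le> j" "tk j = ereal s'" "s' \<le> t" "ereal t < ereal (T + \<delta>)" for j s' t
          proof -
            have "s' = s" using that k tk_inf[of j] by (cases "k = j") auto
            have "hold d (g (y s)) s t y" by (rule hold_subinterval[OF y_hold]) (use that in auto)
            then show ?thesis using hold_cong[of s t x' y] x'_y that \<open>s' = s\<close> by simp
          qed
        qed (use \<delta> k in \<open>auto simp: x'_def\<close>)
        moreover have "\<forall>t. t0 \<le> t \<and> t < T \<longrightarrow> x' t = x t" by (simp add: x'_def)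
        ultimately show ?thesis by blast
      next
        case False
        then obtain e where e: "next_event y (ereal (T + \<delta>)) (ereal s) = ereal e" "T \<le> e" "e < T + \<delta>"
          using no_event_before next_event_cases[of y "ereal (T + \<delta>)" "ereal s"]
          by (cases "next_event y (ereal (T + \<delta>)) (ereal s)") auto
        have "s \<le> e" using e k by simp
        have nonevent: "\<not> event \<gamma> U g y s t" if "s \<le> t" "t < e" for t
          using next_event_le[of s t "ereal (T + \<delta>)" y] that e by auto
        \<comment> \<open>This puts \<open>y e\<close> back into the ball of radius
          \<open>\<rho>\<close>, not just \<open>\<rho> + 1\<close>, so that a local solution of
          full length \<open>\<delta>1\<close> starts there.\<close>
        have "V (y e) \<le> V (y s)"
        proof (rule closed_interval_le[of s e "\<lambda>t. V (y t)" "\<lambda>_. V (y s)"])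
          show "continuous_on {s..e} (\<lambda>t. V (y t))"
            by (intro V_along continuous_on_subset[OF hold_continuous_on[OF y_hold]]) (use e in auto)
          show "V (y t) \<le> V (y s)" if "s \<le> t" "t < e" for t
            by (rule nonevent_V_le[OF hold_subinterval[OF y_hold]])
              (use that e k dD nonevent in auto)
        qed (use \<open>s \<le> e\<close> in auto)
        also have "\<dots> \<le> R" using y_x[of s] x_V[of s] k by simp
        finally have "norm (y e) \<le> \<rho>" by (rule \<rho>)
        \<comment> \<open>If the error vanishes at \<open>e\<close>, the infimum need not be attained; then the new sample leaves the
          input unchanged and \<open>y\<close> is kept, so that its events after \<open>e\<close> are events of the new trajectory.\<close>
        obtain z where z: "z e = y e" "hold d (g (y e)) e (T + \<delta>) z" "\<And>t. e \<le> t \<Longrightarrow> norm (z t) \<le> \<rho> + 1"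
          "g (y e) = g (y s) \<Longrightarrow> z = y"
        proof (cases "g (y e) = g (y s)")
          case True
          then show thesis
            using that[of y] hold_subinterval[OF y_hold \<open>s \<le> e\<close>, of "T + \<delta>"] y_norm \<open>s \<le> e\<close> by simp
        next
          case False
          obtain z where z: "z e = y e" "hold d (g (y e)) e (e + \<delta>1) z" "\<And>t. norm (z t) \<le> \<rho> + 1"
            using start[OF d, of e "y e"] \<open>norm (y e) \<le> \<rho>\<close> \<open>s \<le> e\<close> k by auto
          have "hold d (g (y e)) e (T + \<delta>) z" using z(2) by (rule hold_subinterval) (use e \<delta> in auto)
          then show thesis using that[of z] z False by blast
        qed
        define x' where "x' t = (if t < T then x t else if t \<le> e then y t else z t)" for t
        \<comment> \<open>The first infinite instant becomes \<open>e\<close>; the later ones stay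
          infinite, since no second event fits before the new horizon.\<close>
        define tk' where "tk' = tk(Suc k := ereal e)"
        have x'_y: "x' t = y t" if "s \<le> t" "t \<le> e" for t using that y_x[of t] by (simp add: x'_def)
        have x'_z: "x' t = z t" if "e \<le> t" for t using that z(1) e by (auto simp: x'_def)
        have "next_event x' (ereal (T + \<delta>)) (ereal s) = ereal e"
        proof (cases "g (y e) = g (y s)")
          case True
          then have "x' t = y t" if "s \<le> t" for t
            using x'_y[of t] x'_z[of t] z(4) that by (cases "t \<le> e") auto
          then show ?thesis
            using next_event_restrict[of "ereal (T + \<delta>)" "ereal (T + \<delta>)" s x' y] e by simp
        next
          case False
          have "event \<gamma> U g y s e"
          proof (rule event_at_infimum[OF hold_continuous_on[OF y_hold] \<open>s \<le> e\<close> e(3)])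
            show "sampling_error g y s e \<noteq> 0" using False by (simp add: sampling_error_def)
            fix \<eta> :: real assume "0 < \<eta>"
            then have "next_event y (ereal (T + \<delta>)) (ereal s) < ereal (e + \<eta>)" using e by simp
            from next_event_approx[OF this] obtain t where
              "ereal t < ereal (T + \<delta>)" "ereal t < ereal (e + \<eta>)" "event \<gamma> U g y s t"
              "next_event y (ereal (T + \<delta>)) (ereal s) \<le> ereal t" by blast
            then show "\<exists>t. e \<le> t \<and> t < e + \<eta> \<and> t \<le> T + \<delta> \<and> event \<gamma> U g y s t"
              using e(1) by (intro exI[of _ t]) simp
          qed
          then have ev: "event \<gamma> U g x' s e"
            using event_cong[of s e x' y] x'_y \<open>s \<le> e\<close> by simp
          show ?thesis
          proof (rule antisym)
            show "next_event x' (ereal (T + \<delta>)) (ereal s) \<le> ereal e"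
              using \<open>s \<le> e\<close> e(3) ev by (intro next_event_le) auto
            show "ereal e \<le> next_event x' (ereal (T + \<delta>)) (ereal s)"
            proof (rule ccontr)
              assume "\<not> ?thesis"
              then have "next_event x' (ereal (T + \<delta>)) (ereal s) < ereal e" by simp
              then obtain t where "s \<le> t" "ereal t < ereal e" "event \<gamma> U g x' s t"
                by (rule next_event_approx)
              then show False using nonevent[of t] event_cong[of s t x' y] x'_y by simp
            qed
          qed
        qed
        moreover have "next_event x' (ereal (T + \<delta>)) (ereal e) = \<infinity>"
        proof -
          have "next_event z (ereal (T + \<delta>)) (ereal e) = \<infinity>"
            using z e by (intro no_event) auto
          then show ?thesis
            using next_event_restrict[of "ereal (T + \<delta>)" "ereal (T + \<delta>)" e x' z] x'_z by simp
        qed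
        ultimately have next_x': "next_event x' (ereal (T + \<delta>)) (tk' j) = tk' (Suc j)" if "k \<le> j" for j
        proof -
          consider "j = k" | "j = Suc k" | "Suc k < j" using \<open>k \<le> j\<close> by linarith
          then show ?thesis
            using \<open>next_event x' (ereal (T + \<delta>)) (ereal s) = ereal e\<close>
              \<open>next_event x' (ereal (T + \<delta>)) (ereal e) = \<infinity>\<close> k tk_inf[of j] tk_inf[of "Suc j"]
            by cases (auto simp: tk'_def next_event_infinity)
        qed
        have "run t0 (ereal (T + \<delta>)) d x' tk'"
        proof (rule run_extend[OF run])
          show "tk' (Suc j) = next_event x' (ereal (T + \<delta>)) (tk' j)" if "k \<le> j" for j
            using next_x'[OF that] by simp
          show "hold d (g (x' s')) s' t x'"
            if j: "k \<le> j" "tk' j = ereal s'" and t: "s' \<le> t" "ereal t \<le> tk' (Suc j)" "ereal t < ereal (T + \<delta>)"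
            for j s' t
          proof -
            consider "j = k" | "j = Suc k" | "Suc k < j" using \<open>k \<le> j\<close> by linarith
            then show ?thesis
            proof cases
              case 1
              then have *: "s' = s" "t \<le> e" using j t k by (auto simp: tk'_def)
              have "hold d (g (y s)) s t y" by (rule hold_subinterval[OF y_hold]) (use t in auto)
              then show ?thesis using hold_cong[of s t x' y] x'_y[of s] x'_y t * \<open>s \<le> e\<close> by simp
            next
              case 2
              then have *: "s' = e" using j by (auto simp: tk'_def)
              have "hold d (g (y e)) e t z" by (rule hold_subinterval[OF z(2)]) (use t in auto)
              then show ?thesis using hold_cong[of e t x' z] x'_z[of e] x'_z z(1) t * by simp
            next
              case 3
              then show ?thesis using j tk_inf[of j] by (simp add: tk'_def)
            qed
          qed
          show "tk' (Suc (Suc k)) = \<infinity>" using tk_inf[of "Suc (Suc k)"] by (simp add: tk'_def)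
        qed (use \<delta> k in \<open>auto simp: x'_def tk'_def\<close>)
        moreover have "\<forall>t. t0 \<le> t \<and> t < T \<longrightarrow> x' t = x t" by (simp add: x'_def)
        ultimately show ?thesis by blast
      qed
    qed
  qed
qed

text \<open>The instant sequences \<open>K n\<close> are not prefixes of each other, since each
  replaces its missing instants by \<open>\<infinity>\<close>. So the instants are recomputed along
  the union of the trajectories, and \<open>K n\<close> turns out to be their truncation at
  \<open>T n\<close>.\<close>

lemma run_union:
  assumes runs: "\<And>n. run t0 (ereal (T n)) d (X n) (K n)"
    and agree: "\<And>n t. t0 \<le> t \<Longrightarrow> t < T n \<Longrightarrow> X (Suc n) t = X n t"
    and T: "incseq T" "\<And>r. \<exists>n. r < T n"
  obtains x tk where "run t0 \<infinity> d x tk" "\<And>n t. t0 \<le> t \<Longrightarrow> t < T n \<Longrightarrow> x t = X n t"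
proof -
  have agree': "X n t = X m t" if "m \<le> n" "t0 \<le> t" "t < T m" for m n t
    using that(1)
  proof (induction n rule: dec_induct)
    case (step n)
    have "t < T n" using that(3) incseqD[OF T(1) step(1)] by simp
    then show ?case using agree[OF that(2)] step by simp
  qed simp
  define x where "x t = X (LEAST n. t < T n) t" for t
  have x: "x t = X n t" if "t0 \<le> t" "t < T n" for n t
  proof -
    have "(LEAST n. t < T n) \<le> n" using that(2) by (rule Least_le)
    moreover have "t < T (LEAST n. t < T n)" using that(2) by (rule LeastI)
    ultimately show ?thesis using agree'[of "LEAST n. t < T n" n t] that(1) by (simp add: x_def)
  qed
  define tk where "tk = rec_nat (ereal t0) (\<lambda>_. next_event x \<infinity>)"
  have tk: "tk 0 = ereal t0" "\<And>k. tk (Suc k) = next_event x \<infinity> (tk k)"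
    by (simp_all add: tk_def)
  have K: "K n k = (if tk k < ereal (T n) then tk k else \<infinity>)" for n k
  proof (induction k)
    case 0
    then show ?case using runs[of n] by (simp add: run_def tk)
  next
    case (Suc k)
    have KSuc: "K n (Suc k) = next_event (X n) (ereal (T n)) (K n k)"
      using runs[of n] by (simp add: run_def)
    show ?case
    proof (cases "tk k < ereal (T n)")
      case True
      obtain s where s: "tk k = ereal s" "t0 \<le> s"
        using sampling_instant_ge[OF tk, of k] True by (cases "tk k") auto
      have "next_event (X n) (ereal (T n)) (ereal s) =
          (if next_event x \<infinity> (ereal s) < ereal (T n) then next_event x \<infinity> (ereal s) else \<infinity>)"
        using x[of _ n] s(2) by (intro next_event_restrict) auto
      then show ?thesis using KSuc Suc True s by (simp add: tk)
    next
      case False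
      then have "\<not> tk (Suc k) < ereal (T n)"
        using next_event_ge[of "tk k" x \<infinity>] by (auto simp: tk)
      then show ?thesis using KSuc Suc False by (simp add: next_event_infinity)
    qed
  qed
  have "run t0 \<infinity> d x tk"
    unfolding run_def
  proof (intro conjI allI impI)
    show "hold d (g (x s)) s t x" if "tk k = ereal s \<and> s \<le> t \<and> ereal t \<le> tk (Suc k) \<and> ereal t < \<infinity>"
      for k s t
    proof -
      obtain n where n: "t < T n" using T(2) by blast
      have s: "t0 \<le> s" using sampling_instant_ge[OF tk, of k] that by simp
      have "hold d (g (X n s)) s t (X n)"
      proof (rule run_hold[OF runs])
        show "K n k = ereal s" using that n by (simp add: K)
        show "ereal t \<le> K n (Suc k)" using that by (simp add: K)
      qed (use that n in auto)
      then show ?thesis using hold_cong[of s t x "X n"] x[of _ n] that n s by simp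
    qed
    \<comment> \<open>A run with horizon beyond \<open>r\<close> has an instant above
      \<open>r\<close>. If that instant is \<open>\<infinity>\<close> by truncation, the true
      instant is at least \<open>T n\<close> and again above \<open>r\<close>.\<close>
    have "(SUP k. tk k) = \<infinity>"
    proof (rule ereal_top)
      fix r :: real
      obtain n where n: "max r t0 < T n" using T(2) by blast
      then have "ereal (max r t0) < (SUP k. K n k)"
        using runs[of n] less_le_trans[of "ereal (max r t0)" "ereal (T n)"] by (simp add: run_def)
      then obtain k where "ereal (max r t0) < K n k" by (auto simp: less_SUP_iff)
      then have "ereal r < K n k" using ereal_le_less_trans[of r "max r t0"] by simp
      moreover have "ereal r < tk k" if "ereal (T n) \<le> tk k"
        using n that by (intro ereal_less_le_trans[of r "T n"]) auto
      ultimately have "ereal r < tk k"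
        by (cases "tk k < ereal (T n)") (simp_all add: K not_less)
      then show "ereal r \<le> (SUP k. tk k)" by (meson SUP_upper UNIV_I less_imp_le order_trans)
    qed
    then show "\<infinity> \<le> (SUP k. tk k)" by simp
  qed (use tk in auto)
  then show thesis using x that by blast
qed

text \<open>All finite runs built here start from the same \<open>\<xi>\<close>, so the step
  obtained for the level \<open>V \<xi>\<close> applies at every stage and the horizons tend to
  infinity.\<close>

lemma global_run:
  assumes d: "d \<in> disturbances D t0"
  shows "\<exists>x tk. x t0 = \<xi> \<and> run t0 \<infinity> d x tk"
proof -
  show ?thesis
  proof (rule extension[of t0 "V \<xi>"], goal_cases)
    case ext: (1 \<delta>)
    define T where "T n = t0 + (real n + 1) * \<delta>" for n
    have T: "t0 < T n" "T (Suc n) = T n + \<delta>" for n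
      using ext(1) by (auto simp: T_def algebra_simps add_pos_nonneg)
    have "\<exists>X. \<forall>n. (X n t0 = \<xi> \<and> (\<exists>tk. run t0 (ereal (T n)) d (X n) tk)) \<and>
        (\<forall>t. t0 \<le> t \<and> t < T n \<longrightarrow> X (Suc n) t = X n t)"
    proof (rule dependent_nat_choice)
      show "\<exists>x. x t0 = \<xi> \<and> (\<exists>tk. run t0 (ereal (T 0)) d x tk)"
        using ext(2)[OF d order_refl] by (auto simp: T_def)
      show "\<exists>x'. (x' t0 = \<xi> \<and> (\<exists>tk. run t0 (ereal (T (Suc n))) d x' tk)) \<and>
          (\<forall>t. t0 \<le> t \<and> t < T n \<longrightarrow> x' t = x t)"
        if x: "x t0 = \<xi> \<and> (\<exists>tk. run t0 (ereal (T n)) d x tk)" for x n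
      proof -
        obtain tk where "run t0 (ereal (T n)) d x tk" "x t0 = \<xi>" using x by blast
        then obtain x' tk' where "run t0 (ereal (T (Suc n))) d x' tk'" "\<forall>t. t0 \<le> t \<and> t < T n \<longrightarrow> x' t = x t"
          using ext(3)[OF d, of "T n" x tk] T by auto
        then show ?thesis using \<open>x t0 = \<xi>\<close> T(1)[of n] by auto
      qed
    qed
    then obtain X where X: "\<And>n. X n t0 = \<xi>" "\<And>n. \<exists>tk. run t0 (ereal (T n)) d (X n) tk"
      "\<And>n t. t0 \<le> t \<Longrightarrow> t < T n \<Longrightarrow> X (Suc n) t = X n t" by blast
    obtain K where K: "\<And>n. run t0 (ereal (T n)) d (X n) (K n)" using X(2) by metis
    have incseq: "incseq T" using ext(1) by (intro incseq_SucI) (simp add: T)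
    have unbounded: "\<exists>n. r < T n" for r
    proof -
      obtain n where "(r - t0) / \<delta> < real n" using reals_Archimedean2 by blast
      then show ?thesis using ext(1) by (intro exI[of _ n]) (simp add: T_def field_simps)
    qed
    show ?case
    proof (rule run_union[of t0 T d X K, OF K X(3) incseq unbounded])
      show ?case if "run t0 \<infinity> d x tk" "\<And>n t. t0 \<le> t \<Longrightarrow> t < T n \<Longrightarrow> x t = X n t" for x tk
        using that(2)[of t0 0] X(1)[of 0] T(1)[of 0] that(1) by auto
    qed
  qed
qed

section \<open>Maximal solutions and asymptotic stability\<close>

lemma run_extends:
  assumes "d \<in> disturbances D t0" "run t0 (ereal T) d x tk"
  shows "\<exists>T' x' tk'. ereal T < T' \<and> run t0 T' d x' tk' \<and> (\<forall>t. t0 \<le> t \<and> ereal t < ereal T \<longrightarrow> x' t = x t)"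
proof (rule extension[of t0 "V (x t0)"], goal_cases)
  case ext: (1 \<delta>)
  then show ?case using ext(3)[OF assms order_refl] by (intro exI[of _ "ereal (T + \<delta>)"]) auto
qed

lemma globally_asymptotically_stable_run:
  "globally_asymptotically_stable t0 (disturbances D t0) (\<lambda>T d x. \<exists>tk. run t0 T d x tk)"
  unfolding globally_asymptotically_stable_def
proof (intro conjI ballI allI impI)
  have d: "d t \<in> D" if "d \<in> disturbances D t0" "t0 \<le> t" for d t
    using that by (simp add: disturbances_def)
  show "\<exists>x. x t0 = \<xi> \<and> (\<exists>tk. run t0 \<infinity> d x tk)" if "d \<in> disturbances D t0" for d \<xi>
    using global_run[OF that] by blast
  show "T = \<infinity>" if W: "d \<in> disturbances D t0" and
    max: "maximal_solution t0 (\<lambda>T d x. \<exists>tk. run t0 T d x tk) T d x" for d T x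
  proof (cases T)
    case (real r)
    then show ?thesis using max run_extends[OF W, of r x] unfolding maximal_solution_def by blast
  next
    case MInf
    then show ?thesis using max by (auto simp: maximal_solution_def run_def)
  qed simp
  have V_le: "\<alpha>_lo (norm (x t)) \<le> \<alpha>_hi r"
    if "d \<in> disturbances D t0" "\<exists>tk. run t0 T d x tk" "norm (x t0) \<le> r" "t0 \<le> t" "ereal t < T" for d T x t r
  proof -
    have "V (x t) \<le> V (x t0)" using that d run_V_le by blast
    moreover have "\<alpha>_hi (norm (x t0)) \<le> \<alpha>_hi r" using that(3) by (rule class_K_inf_mono[OF class_K(2) norm_ge_zero])
    ultimately show ?thesis using V_bounds(1)[of "x t"] V_bounds(2)[of "x t0"] by simp
  qed
  show "\<exists>\<delta>>0. \<forall>d\<in>disturbances D t0. \<forall>T x. (\<exists>tk. run t0 T d x tk) \<and> norm (x t0) < \<delta> \<longrightarrow>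
      (\<forall>t. t0 \<le> t \<and> ereal t < T \<longrightarrow> norm (x t) < \<epsilon>)" if "0 < \<epsilon>" for \<epsilon>
  proof -
    have "0 < \<alpha>_lo (\<epsilon> / 2)" using class_K_inf_pos[OF class_K(1)] that by simp
    then obtain \<delta> where \<delta>: "0 < \<delta>" "\<alpha>_hi \<delta> \<le> \<alpha>_lo (\<epsilon> / 2)" using class_K_inf_small[OF class_K(2)] by blast
    have "norm (x t) < \<epsilon>"
      if "d \<in> disturbances D t0" "\<exists>tk. run t0 T d x tk" "norm (x t0) < \<delta>" "t0 \<le> t" "ereal t < T" for d T x t
    proof -
      have "\<alpha>_lo (norm (x t)) \<le> \<alpha>_hi \<delta>"
        by (rule V_le[OF that(1,2) less_imp_le[OF that(3)] that(4,5)])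
      then have "\<alpha>_lo (norm (x t)) \<le> \<alpha>_lo (\<epsilon> / 2)" using \<delta>(2) by simp
      then have "norm (x t) \<le> \<epsilon> / 2" using class_K_inf_le_imp_le[OF class_K(1), of "\<epsilon> / 2"] \<open>0 < \<epsilon>\<close> by simp
      then show ?thesis using \<open>0 < \<epsilon>\<close> by simp
    qed
    then show ?thesis using \<delta>(1) by blast
  qed
  show "\<exists>B. \<forall>d\<in>disturbances D t0. \<forall>T x. (\<exists>tk. run t0 T d x tk) \<and> norm (x t0) \<le> r \<longrightarrow>
      (\<forall>t. t0 \<le> t \<and> ereal t < T \<longrightarrow> norm (x t) \<le> B)" for r
  proof -
    obtain B where "\<And>s. \<alpha>_lo s \<le> \<alpha>_hi r \<Longrightarrow> s \<le> B" using class_K_inf_bounded_preimage[OF class_K(1)] by metis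
    then show ?thesis using V_le by blast
  qed
  show "\<exists>\<theta>\<ge>0. \<forall>d\<in>disturbances D t0. \<forall>T x. (\<exists>tk. run t0 T d x tk) \<and> norm (x t0) \<le> r \<longrightarrow>
      (\<forall>t. t0 + \<theta> \<le> t \<and> ereal t < T \<longrightarrow> norm (x t) < \<epsilon>)" if "0 < r" "0 < \<epsilon>" for r \<epsilon>
  proof -
    \<comment> \<open>Half of \<open>\<epsilon>\<close> turns the weak inequality for
      \<open>V\<close> into the strict one for the norm.\<close>
    define v where "v = \<alpha>_lo (\<epsilon> / 2)"
    have "0 < v" using class_K_inf_pos[OF class_K(1)] \<open>0 < \<epsilon>\<close> by (simp add: v_def)
    then obtain c w0 where c: "0 < c" "0 < w0" "\<And>x. v \<le> V x \<Longrightarrow> c \<le> \<alpha> (norm x) - \<sigma> w0"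
      using level_constants by blast
    define c' where "c' = min c (2 * \<gamma> w0)"
    have "0 < c'" using c(1) class_K_inf_pos[OF K_\<gamma> c(2)] by (simp add: c'_def)
    \<comment> \<open>The time in which decay at rate \<open>c'\<close> would bring \<open>V\<close>
      from \<open>\<alpha>_hi r\<close> down to 0; afterwards \<open>v\<close> is the larger term in
      \<open>run_decay\<close>.\<close>
    define \<theta> where "\<theta> = \<alpha>_hi r / c'"
    have "0 \<le> \<theta>" using class_K_inf_nonneg[OF class_K(2), of r] \<open>0 < r\<close> \<open>0 < c'\<close> by (simp add: \<theta>_def)
    have "norm (x t) < \<epsilon>"
      if W: "d \<in> disturbances D t0" and run: "run t0 T d x tk" and x0: "norm (x t0) \<le> r"
        and t: "t0 + \<theta> \<le> t" "ereal t < T" for d T x tk t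
    proof -
      have "V (x t) \<le> max v (V (x t0) - c' * (t - t0))"
        unfolding c'_def using t \<open>0 \<le> \<theta>\<close> d[OF W] by (intro run_decay[OF run _ c(2,1,3)]) auto
      moreover have "V (x t0) \<le> \<alpha>_hi r"
        using V_bounds(2)[of "x t0"] class_K_inf_mono[OF class_K(2) norm_ge_zero x0] by simp
      moreover have "\<alpha>_hi r \<le> c' * (t - t0)"
        using t(1) \<open>0 < c'\<close> by (simp add: \<theta>_def field_simps)
      ultimately have "V (x t) \<le> v" using \<open>0 < v\<close> by simp
      then have "\<alpha>_lo (norm (x t)) \<le> \<alpha>_lo (\<epsilon> / 2)" using V_bounds(1)[of "x t"] by (simp add: v_def)
      then have "norm (x t) \<le> \<epsilon> / 2" using class_K_inf_le_imp_le[OF class_K(1), of "\<epsilon> / 2"] \<open>0 < \<epsilon>\<close> by simp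
      then show ?thesis using \<open>0 < \<epsilon>\<close> by simp
    qed
    then show ?thesis using \<open>0 \<le> \<theta>\<close> by blast
  qed
qed

end

theorem mainTheorem1:
  fixes f :: "real ^ 'n \<Rightarrow> real ^ 'm \<Rightarrow> real ^ 'nd \<Rightarrow> real ^ 'n"
    and h :: "real ^ 'n \<Rightarrow> real ^ 'q"
    and \<kappa> :: "real ^ 'q \<Rightarrow> real ^ 'm"
    and D :: "(real ^ 'nd) set"
    and V V_q :: "real ^ 'n \<Rightarrow> real"
    and U :: "real ^ 'm \<Rightarrow> real"
    and t0 :: real
  assumes "compact D"
    and "continuously_differentiable (\<lambda>(x, u, d). f x u d)"
    and "\<And>d. d \<in> D \<Longrightarrow> f 0 0 d = 0"
    and "h 0 = 0"
    and "continuously_differentiable \<kappa>" and "\<kappa> 0 = 0"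
    and "\<And>x. (\<kappa> \<circ> h) differentiable (at x)"
    and "ISS_Lyapunov V \<alpha>_lo \<alpha>_hi \<alpha> \<sigma> (f_c f (\<kappa> \<circ> h)) D"
    and "error_growth U \<alpha>w_lo \<alpha>w_hi \<alpha>w \<sigma>w (psi f (\<kappa> \<circ> h)) D"
    and "class_K_inf \<alpha>_q"
    and "\<And>s. s > 0 \<Longrightarrow> \<alpha>_q s > 2 * \<sigma>w s"
    and "bigO_at_zero \<alpha>_q \<alpha>"
    and "ISS_Lyapunov V_q \<alpha>q_lo \<alpha>q_hi \<alpha>_q \<sigma>_q (f_c f (\<kappa> \<circ> h)) D"
    and "class_K_inf \<alpha>w_hat" and "class_K_inf \<gamma>"
    and "\<And>s. s > 0 \<Longrightarrow> \<alpha>w_hat s > \<sigma>_q s / 2"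
    and "\<And>s. s > 0 \<Longrightarrow> \<gamma> s > \<alpha>w_hat s + \<alpha>w s"
    and "bigO_at_zero \<sigma>w \<alpha>"
    and "bigO_at_zero \<gamma> \<alpha>w_lo"
  shows "globally_asymptotically_stable t0 (disturbances D t0)
           (closed_loop_solution f \<kappa> h \<gamma> U t0) \<and>
         (\<forall>d \<in> disturbances D t0. \<forall>T x tk. execution f \<kappa> h \<gamma> U t0 T d x tk \<longrightarrow>
           (\<forall>s::real. finite {k. tk k \<le> ereal s}) \<and>
           (\<forall>k t. tk k \<le> ereal t \<and> ereal t \<le> tk (Suc k) \<and> ereal t < T \<longrightarrow>
              V_q (x t) \<le> V_q (x (real_of_ereal (tk k)))))"
proof -
  interpret event_triggered_loop f D "\<kappa> \<circ> h" V_q \<alpha>q_lo \<alpha>q_hi \<alpha>_q \<sigma>_q U \<alpha>w_lo \<alpha>w_hi \<alpha>w \<sigma>w \<gamma>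
  proof
    \<comment> \<open>The strict inequalities are given for positive arguments; the locale needs the
      weak ones at 0 as well, where all functions vanish.\<close>
    have zero: "\<sigma>w 0 = 0" "\<alpha>w 0 = 0" "\<sigma>_q 0 = 0" "\<alpha>_q 0 = 0" "\<gamma> 0 = 0"
      using assms(9,13,15) by (auto simp: error_growth_def ISS_Lyapunov_def class_K_inf_zero)
    show "2 * \<sigma>w s \<le> \<alpha>_q s" if "0 \<le> s" for s
      using assms(11)[of s] zero that by (cases "s = 0") auto
    show "\<sigma>_q s + 2 * \<alpha>w s \<le> 2 * \<gamma> s" if "0 \<le> s" for s
      using assms(16,17)[of s] zero that by (cases "s = 0") auto
  qed fact+
  have run: "execution f \<kappa> h \<gamma> U t0 T d x tk \<longleftrightarrow> run t0 T d x tk" for T d x tk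
    by (rule execution_iff_run) (rule refl)
  have "closed_loop_solution f \<kappa> h \<gamma> U t0 = (\<lambda>T d x. \<exists>tk. run t0 T d x tk)"
    by (intro ext) (simp only: closed_loop_solution_def run)
  then have stable: "globally_asymptotically_stable t0 (disturbances D t0) (closed_loop_solution f \<kappa> h \<gamma> U t0)"
    using globally_asymptotically_stable_run by simp
  have "finite {k. tk k \<le> ereal s}" "tk k \<le> ereal t \<and> ereal t \<le> tk (Suc k) \<and> ereal t < T \<longrightarrow>
      V_q (x t) \<le> V_q (x (real_of_ereal (tk k)))"
    if d: "d \<in> disturbances D t0" and r: "run t0 T d x tk" for d T x tk s k t
  proof -
    have dD: "d t \<in> D" if "t0 \<le> t" for t using d that by (simp add: disturbances_def)
    show "finite {k. tk k \<le> ereal s}" by (rule run_finitely_many[OF r dD])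
    show "tk k \<le> ereal t \<and> ereal t \<le> tk (Suc k) \<and> ereal t < T \<longrightarrow>
        V_q (x t) \<le> V_q (x (real_of_ereal (tk k)))"
    proof
      assume t: "tk k \<le> ereal t \<and> ereal t \<le> tk (Suc k) \<and> ereal t < T"
      then obtain s where "tk k = ereal s" "s \<le> t"
        using run_ge[OF r, of k] by (cases "tk k") auto
      then show "V_q (x t) \<le> V_q (x (real_of_ereal (tk k)))"
        using run_piece_V_le[OF r dD, of k s t] t by simp
    qed
  qed
  with stable show ?thesis by (simp only: run) blast
qed

end
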